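(* Let $m\ge 1$, let $B\subset\mathbb{R}^3$ be a bounded domain, and let $\gamma\subset\mathbb{R}^3$ be a curve that satisfies the Kirillov-Tuy condition of order $m$ (with respect to $B$) and encompasses $B$. Let $f$ be a smooth compactly supported symmetric $m$-tensor field in $\mathbb{R}^3$ whose support is contained in $B$. Suppose that the transverse ray transforms $\mathcal{T}_i f$, $i=0,\dots,m$, are known for all lines intersecting $\gamma$, i.e. that $\mathcal{T}_if(a,\xi)$ is known for all $a\in\gamma$, $\xi\in\mathbb{S}^2$ and $0\le i\le m$. Then $f$ can be uniquely reconstructed from these data; that is, if $f$ and $g$ are two smooth compactly supported symmetric $m$-tensor fields supported in $B$ with $\mathcal{T}_if(a,\xi)=\mathcal{T}_ig(a,\xi)$ for all $a\in\gamma$, $\xi\in\mathbb{S}^2$ and $0\le i\le m$, then $f=g$.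
   Context: Tensor fields. A symmetric $m$-tensor field on $\mathbb{R}^3$ is written $f(x)=f_{i_1\dots i_m}(x)\,dx^{i_1}\cdots dx^{i_m}$, with components symmetric in the indices (summation over repeated indices). For vectors $y_1,\dots,y_m\in\mathbb{R}^3$, $\langle f(x), y_1\odot\cdots\odot y_m\rangle=f_{i_1\dots i_m}(x)y_1^{i_1}\cdots y_m^{i_m}$, where $\odot$ is the symmetrized tensor product and $y^{\odot k}$ is the $k$-th symmetric power of $y$. Frame. Each $\xi\in\mathbb{S}^2$ is written as $\xi=(\sin\varphi_1\sin\varphi_2,\ \sin\varphi_1\cos\varphi_2,\ \cos\varphi_1)$ with $\varphi_1\in[0,\pi]$, $\varphi_2\in[0,2\pi)$ (where the angles are not unique, fix any choice). Put $\xi_\alpha=(\cos\varphi_1\sin\varphi_2,\ \cos\varphi_1\cos\varphi_2,\ -\sin\varphi_1)$ and $\xi_\beta=(\cos\varphi_2,\ -\sin\varphi_2,\ 0)$. Then $\{\xi,\xi_\alpha,\xi_\beta\}$ is an orthonormal basis of $\mathbb{R}^3$. Transverse ray transform. For $0\le i\le m$, $\mathcal{T}_if(x,\xi)=\int_{\mathbb{R}}\langle f(x+t\xi),\ \xi_\alpha^{\odot i}\odot\xi_\beta^{\odot(m-i)}\rangle\,dt$. Generic vectors. Put $\nu(m,n)=\binom{m+n-2}{m}$, so $\nu(m,3)=m+1$. Vectors $e_1,\dots,e_{\nu(m,n)}$ in an $(n-1)$-dimensional real vector space are generic if every symmetric tensor $h$ of order $m$ on that space is uniquely determined by the values $\langle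 h,e_1^{\odot m}\rangle,\dots,\langle h,e_{\nu(m,n)}^{\odot m}\rangle$. Kirillov-Tuy condition of order $m$ (for the domain $B\subset\mathbb{R}^n$; here $n=3$). For $\omega\in\mathbb{S}^{n-1}$, $p\in\mathbb{R}$ let $H_{\omega,p}=\{x\in\mathbb{R}^n:\langle\omega,x\rangle=p\}$. The curve $\gamma$ satisfies the condition if for almost every hyperplane $H_{\omega,p}$ intersecting $B$ there are points $\gamma_1,\dots,\gamma_{\nu(m,n)}\in H_{\omega,p}\cap\gamma$, depending locally smoothly on $(\omega,p)$, such that for almost every $x\in H_{\omega,p}\cap B$ the vectors $x-\gamma_1,\dots,x-\gamma_{\nu(m,n)}$ (which lie in the $(n-1)$-dimensional space $\omega^\perp$) are generic. Encompassing. A curve $\gamma$ encompasses a bounded domain $B$ if $\gamma\cap B=\emptyset$ and for each $a\in\gamma$ and $\xi\in\mathbb{R}^n\setminus\{0\}$ at most one of the rays $\{a+t\xi:t\ge0\}$, $\{a+t\xi:t\le0\}$ intersects $B$. *)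

theory Defs
  imports "HOL-Analysis.Analysis"
begin

section \<open>Smooth functions on open sets\<close>

fun higher_differentiable_on ::
  "nat \<Rightarrow> 'a::real_normed_vector set \<Rightarrow> ('a \<Rightarrow> 'b::real_normed_vector) \<Rightarrow> bool" where
  "higher_differentiable_on 0 S f \<longleftrightarrow> continuous_on S f"
| "higher_differentiable_on (Suc k) S f \<longleftrightarrow>
     (\<forall>x\<in>S. f differentiable (at x)) \<and>
     (\<forall>v. higher_differentiable_on k S (\<lambda>x. frechet_derivative f (at x) v))"

text \<open>Intended for open \<open>S\<close> in a finite-dimensional space, where it is the usual \<open>C\<^sup>\<infinity>\<close>.\<close>

definition smooth_on ::
  "'a::real_normed_vector set \<Rightarrow> ('a \<Rightarrow> 'b::real_normed_vector) \<Rightarrow> bool" where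
  "smooth_on S f \<longleftrightarrow> (\<forall>k. higher_differentiable_on k S f)"


section \<open>Symmetric tensor fields\<close>

text \<open>A tensor of order \<open>m\<close> on \<open>real ^ 'n\<close> is given by its components, indexed by the lists of
  length \<open>m\<close> over \<open>'n\<close>. Components at lists of any other length are fixed to be \<open>0\<close>, so
  that two tensors of order \<open>m\<close> are the same iff they are equal as functions.\<close>

type_synonym 'n tensor = "'n list \<Rightarrow> real"

definition symmetric_tensor :: "nat \<Rightarrow> 'n tensor \<Rightarrow> bool" where
  "symmetric_tensor m h \<longleftrightarrow>
     (\<forall>is. length is \<noteq> m \<longrightarrow> h is = 0) \<and>
     (\<forall>is js. mset is = mset js \<longrightarrow> h is = h js)"

text \<open>For a list \<open>ys\<close> of \<open>m\<close> vectors, the pairing of \<open>h\<close> with their symmetrized product.\<close>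

definition tensor_pairing :: "('n::finite) tensor \<Rightarrow> (real ^ 'n) list \<Rightarrow> real" where
  "tensor_pairing h ys =
     (\<Sum>is | length is = length ys. h is * (\<Prod>k<length ys. (ys ! k) $ (is ! k)))"

definition field_support :: "('a::topological_space \<Rightarrow> 'n tensor) \<Rightarrow> 'a set" where
  "field_support f = closure {x. \<exists>is. f x is \<noteq> 0}"

definition smooth_compact_symmetric_field ::
  "nat \<Rightarrow> ((real ^ 'n::finite) \<Rightarrow> 'n tensor) \<Rightarrow> bool" where
  "smooth_compact_symmetric_field m f \<longleftrightarrow>
     (\<forall>x. symmetric_tensor m (f x)) \<and>
     (\<forall>is. smooth_on UNIV (\<lambda>x. f x is)) \<and>
     compact (field_support f)"


section \<open>Spherical frame and transverse ray transform\<close>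

definition sph_xi :: "real \<Rightarrow> real \<Rightarrow> real ^ 3" where
  "sph_xi \<phi>\<^sub>1 \<phi>\<^sub>2 = vector [sin \<phi>\<^sub>1 * sin \<phi>\<^sub>2, sin \<phi>\<^sub>1 * cos \<phi>\<^sub>2, cos \<phi>\<^sub>1]"

definition sph_alpha :: "real \<Rightarrow> real \<Rightarrow> real ^ 3" where
  "sph_alpha \<phi>\<^sub>1 \<phi>\<^sub>2 = vector [cos \<phi>\<^sub>1 * sin \<phi>\<^sub>2, cos \<phi>\<^sub>1 * cos \<phi>\<^sub>2, - sin \<phi>\<^sub>1]"

definition sph_beta :: "real \<Rightarrow> real \<Rightarrow> real ^ 3" where
  "sph_beta \<phi>\<^sub>1 \<phi>\<^sub>2 = vector [cos \<phi>\<^sub>2, - sin \<phi>\<^sub>2, 0]"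

text \<open>A choice of angles for every unit vector; only at the poles is there any freedom.\<close>

definition angle_choice :: "(real ^ 3 \<Rightarrow> real) \<Rightarrow> (real ^ 3 \<Rightarrow> real) \<Rightarrow> bool" where
  "angle_choice \<Phi>\<^sub>1 \<Phi>\<^sub>2 \<longleftrightarrow>
     (\<forall>\<xi>\<in>sphere 0 1. \<Phi>\<^sub>1 \<xi> \<in> {0..pi} \<and> \<Phi>\<^sub>2 \<xi> \<in> {0..<2 * pi} \<and> \<xi> = sph_xi (\<Phi>\<^sub>1 \<xi>) (\<Phi>\<^sub>2 \<xi>))"

definition transverse_ray_transform ::
  "(real ^ 3 \<Rightarrow> real) \<Rightarrow> (real ^ 3 \<Rightarrow> real) \<Rightarrow> nat \<Rightarrow> nat \<Rightarrow>
   (real ^ 3 \<Rightarrow> 3 tensor) \<Rightarrow> real ^ 3 \<Rightarrow> real ^ 3 \<Rightarrow> real" where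
  "transverse_ray_transform \<Phi>\<^sub>1 \<Phi>\<^sub>2 m i f x \<xi> =
     (LINT t|lborel.
        tensor_pairing (f (x + t *\<^sub>R \<xi>))
          (replicate i (sph_alpha (\<Phi>\<^sub>1 \<xi>) (\<Phi>\<^sub>2 \<xi>)) @
           replicate (m - i) (sph_beta (\<Phi>\<^sub>1 \<xi>) (\<Phi>\<^sub>2 \<xi>))))"


section \<open>Generic vectors\<close>

text \<open>Symmetric tensors of order \<open>m\<close> on a subspace \<open>V\<close>, as symmetric \<open>m\<close>-linear forms on
  \<open>V\<close>. The value of \<open>h\<close> outside \<open>V\<^sup>m\<close> is irrelevant.\<close>

definition symmetric_form_on ::
  "nat \<Rightarrow> 'a::real_vector set \<Rightarrow> ('a list \<Rightarrow> real) \<Rightarrow> bool" where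
  "symmetric_form_on m V h \<longleftrightarrow>
     (\<forall>ys k u v a b. length ys = m \<and> set ys \<subseteq> V \<and> k < m \<and> u \<in> V \<and> v \<in> V \<longrightarrow>
        h (ys[k := a *\<^sub>R u + b *\<^sub>R v]) = a * h (ys[k := u]) + b * h (ys[k := v])) \<and>
     (\<forall>ys zs. length ys = m \<and> set ys \<subseteq> V \<and> mset ys = mset zs \<longrightarrow> h ys = h zs)"

definition nu :: "nat \<Rightarrow> nat \<Rightarrow> nat" where
  "nu m n = (m + n - 2) choose m"

definition generic_vectors ::
  "nat \<Rightarrow> 'a::real_vector set \<Rightarrow> nat \<Rightarrow> (nat \<Rightarrow> 'a) \<Rightarrow> bool" where
  "generic_vectors m V N e \<longleftrightarrow>
     (\<forall>k\<in>{1..N}. e k \<in> V) \<and>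
     (\<forall>h h'. symmetric_form_on m V h \<and> symmetric_form_on m V h' \<and>
        (\<forall>k\<in>{1..N}. h (replicate m (e k)) = h' (replicate m (e k))) \<longrightarrow>
        (\<forall>ys. length ys = m \<and> set ys \<subseteq> V \<longrightarrow> h ys = h' ys))"


section \<open>Hyperplanes and the Kirillov-Tuy condition\<close>

definition hyperplane :: "'a::euclidean_space \<Rightarrow> real \<Rightarrow> 'a set" where
  "hyperplane \<omega> p = {x. \<omega> \<bullet> x = p}"

text \<open>Surface measure on the unit sphere, as a Borel measure on the whole space: the measure of
  \<open>A\<close> is \<open>n\<close> times the volume of the cone over \<open>A\<close> in the unit ball (in polar coordinates
  that volume is the surface area times the integral of \<open>r\<^bsup>n - 1\<^esup>\<close> over \<open>[0, 1]\<close>).\<close>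

definition sphere_measure :: "'a::euclidean_space measure" where
  "sphere_measure =
     scale_measure (of_nat DIM('a)) (distr (restrict_space lborel (ball 0 1)) borel sgn)"

text \<open>The \<open>n - 1\<close>-dimensional Lebesgue measure of the hyperplane, as a Borel measure on the whole
  space, for \<open>\<omega>\<close> of norm \<open>1\<close>: the measure of \<open>A\<close> is the volume of the right cylinder of
  height \<open>1\<close> over the part of \<open>A\<close> in the hyperplane.\<close>

definition hyperplane_measure :: "'a::euclidean_space \<Rightarrow> real \<Rightarrow> 'a measure" where
  "hyperplane_measure \<omega> p =
     distr (restrict_space lborel {x. p \<le> \<omega> \<bullet> x \<and> \<omega> \<bullet> x \<le> p + 1}) borel
       (\<lambda>x. x - (\<omega> \<bullet> x - p) *\<^sub>R \<omega>)"

text \<open>Local smooth dependence on \<open>(\<omega>, p)\<close> in the manifold of unit vectors times reals is expressed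
  by smooth maps on a neighbourhood of \<open>(\<omega>, p)\<close> in the ambient space, which is what smoothness
  on a submanifold means. Only their values at unit vectors are constrained.\<close>

definition kirillov_tuy :: "nat \<Rightarrow> 'a::euclidean_space set \<Rightarrow> 'a set \<Rightarrow> bool" where
  "kirillov_tuy m B \<gamma> \<longleftrightarrow>
     (AE (\<omega>, p) in sphere_measure \<Otimes>\<^sub>M lborel.
        hyperplane \<omega> p \<inter> B \<noteq> {} \<longrightarrow>
        (\<exists>W (G :: nat \<Rightarrow> 'a \<times> real \<Rightarrow> 'a).
           open W \<and> (\<omega>, p) \<in> W \<and>
           (\<forall>k\<in>{1..nu m DIM('a)}. smooth_on W (G k) \<and>
              (\<forall>(\<omega>', p')\<in>W. norm \<omega>' = 1 \<longrightarrow> G k (\<omega>', p') \<in> hyperplane \<omega>' p' \<inter> \<gamma>)) \<and>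
           (AE x in hyperplane_measure \<omega> p. x \<in> B \<longrightarrow>
              generic_vectors m (hyperplane \<omega> 0) (nu m DIM('a)) (\<lambda>k. x - G k (\<omega>, p)))))"


section \<open>Domains and curves\<close>

definition bounded_domain :: "'a::euclidean_space set \<Rightarrow> bool" where
  "bounded_domain B \<longleftrightarrow> open B \<and> connected B \<and> B \<noteq> {} \<and> bounded B"

definition curve :: "'a::euclidean_space set \<Rightarrow> bool" where
  "curve \<gamma> \<longleftrightarrow> (\<exists>(I :: real set) c. is_interval I \<and> continuous_on I c \<and> \<gamma> = c ` I)"

definition encompasses :: "'a::euclidean_space set \<Rightarrow> 'a set \<Rightarrow> bool" where
  "encompasses \<gamma> B \<longleftrightarrow>
     \<gamma> \<inter> B = {} \<and>
     (\<forall>a\<in>\<gamma>. \<forall>\<xi>. \<xi> \<noteq> 0 \<longrightarrow>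
        {a + t *\<^sub>R \<xi> | t. 0 \<le> t} \<inter> B = {} \<or> {a + t *\<^sub>R \<xi> | t. t \<le> 0} \<inter> B = {})"

end

theory Submission
  imports Defs
begin

text \<open>
  Put \<open>h = f - g\<close>, a field with compact support \<open>K \<subseteq> B\<close>. Since \<open>\<xi>\<^sub>\<alpha>\<close> and \<open>\<xi>\<^sub>\<beta>\<close> span the
  orthogonal complement of \<open>\<xi>\<close>, the binomial formula turns equality of all transforms into
  \<open>\<integral> \<langle>h (a + t \<xi>), \<eta>\<^sup>m\<rangle> dt = 0\<close> for all \<open>a \<in> \<gamma>\<close>, \<open>\<xi> \<noteq> 0\<close> and \<open>\<eta>\<close> orthogonal to \<open>\<xi>\<close>
  (\<open>vanishing_transverse_data\<close>). This information is moved from rays to planes and from planes to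
  the Laplace transform of \<open>h\<close>.

  \<^emph>\<open>Rays to planes.\<close> Fix \<open>\<omega>\<close> and \<open>\<theta>\<close> with \<open>\<omega>\<^sub>3 \<noteq> 0 = \<theta>\<^sub>3\<close> and let \<open>d = e\<^sub>3 / \<omega>\<^sub>3\<close>, so that
  \<open>\<omega> \<bullet> d = 1\<close> and \<open>\<theta> \<bullet> d = 0\<close>. For \<open>\<xi>\<close> orthogonal to \<open>\<omega>\<close>, the vector
  \<open>s \<theta> - (\<theta> \<bullet> \<xi>) \<omega>\<close> is orthogonal to \<open>\<xi> + s d\<close>, so it may be used as \<open>\<eta>\<close> on that ray. Apply the
  derivative of order \<open>m + 1\<close> at \<open>s = 0\<close>: the summand carrying \<open>s\<close> to the power \<open>m - l\<close> keeps
  \<open>l + 1\<close> derivatives of \<open>h\<close> along \<open>d\<close>, and each of them brings a factor \<open>t\<close>. Of these factors,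
  \<open>l\<close> combine with powers of \<open>\<theta> \<bullet> \<xi>\<close> into powers of \<open>\<theta> \<bullet> (x - a)\<close>. Because \<open>\<gamma>\<close> encompasses \<open>B\<close>, the
  remaining one is \<open>\<bar>t\<bar>\<close> up to a sign that is constant along the ray, and \<open>\<bar>t\<bar>\<close> is the Jacobian of the fan of
  rays from \<open>a\<close> in the plane. Integrating over the fan gives (\<open>plane_identity\<close>)
  \<open>\<Sum>l\<le>m. (m choose l) / (l + 1)! * \<integral> (\<theta> \<bullet> a - \<theta> \<bullet> x)\<^sup>l \<langle>\<partial>\<^sub>d\<^bsup>l + 1\<^esup> h (x), \<omega>\<^sup>l \<theta>\<^bsup>m - l\<^esup>\<rangle> = 0\<close>,
  where \<open>x\<close> runs through the plane with normal \<open>\<omega>\<close> through \<open>a\<close>.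

  On a fixed plane the source \<open>a\<close> enters only through the number \<open>\<theta> \<bullet> a\<close>, in which the left hand side
  is a polynomial of degree at most \<open>m\<close>. The Kirillov-Tuy condition provides \<open>m + 1\<close> points of
  \<open>\<gamma>\<close> in almost every plane that meets \<open>B\<close>; they are distinct, since generic vectors are
  (\<open>generic_vectors_distinct\<close>). Hence for almost every \<open>\<theta>\<close>, and by continuity for all, each
  coefficient of the polynomial vanishes (\<open>plane_coefficients_vanish\<close>).

  \<^emph>\<open>Planes to Laplace transform.\<close> Integrate these coefficients over all planes \<open>\<omega> \<bullet> x = p\<close>
  with weight \<open>e\<^sup>p\<close>. Integration by parts removes the derivatives (\<open>laplace_identity\<close>) and leaves
  relations between the moments \<open>A q i k = \<integral> e\<^bsup>k \<bullet> x\<^esup> (\<theta> \<bullet> x)\<^sup>q \<langle>h x, \<theta>\<^sup>i k\<^bsup>m - i\<^esup>\<rangle> dx\<close>, first for a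
  dense set of \<open>k\<close>, then for all. The derivative of \<open>A q i\<close> in direction \<open>\<theta>\<close> is
  \<open>A (q + 1) i + (m - i) A q (i + 1)\<close>. This makes the relations triangular with diagonal entries
  that are Beta integrals up to nonzero factors, so \<open>A 0 J\<close> vanishes for all \<open>J \<le> m\<close>
  (\<open>moment_hierarchy_trivial\<close>). For \<open>k\<^sub>3 \<noteq> 0\<close>
  every vector is some \<open>\<theta> + c k\<close>, so the Laplace transform of \<open>\<langle>h, v\<^sup>m\<rangle>\<close> vanishes for every \<open>v\<close>.
  By the Stone-Weierstrass theorem \<open>\<langle>h, v\<^sup>m\<rangle> = 0\<close>, and polarization gives \<open>h = 0\<close>.
\<close>

section \<open>Pairing symmetric tensors with vectors\<close>

definition perm_invariant :: "'n tensor \<Rightarrow> bool" where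
  "perm_invariant h \<longleftrightarrow> (\<forall>is js. mset is = mset js \<longrightarrow> h is = h js)"

lemma perm_invariant_Cons: "perm_invariant h \<Longrightarrow> perm_invariant (\<lambda>is. h (j # is))"
  by (simp add: perm_invariant_def)

lemma tensor_pairing_Nil [simp]: "tensor_pairing h [] = h []"
  by (simp add: tensor_pairing_def)

text \<open>Contraction with the first vector: pairings are computed, and all their properties proved, by
  recursion on the list of vectors.\<close>

lemma tensor_pairing_Cons:
  fixes h :: "'n::finite tensor"
  shows "tensor_pairing h (v # vs) = (\<Sum>j\<in>UNIV. v $ j * tensor_pairing (\<lambda>is. h (j # is)) vs)"
proof -
  have *: "{is. length is = Suc (length vs)} = (\<lambda>(j, is). j # is) ` (UNIV \<times> {is::'n list. length is = length vs})"
    by (auto simp: length_Suc_conv image_iff)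
  have "tensor_pairing h (v # vs) =
      (\<Sum>(j, is)\<in>UNIV \<times> {is. length is = length vs}. h (j # is) * (v $ j * (\<Prod>k<length vs. (vs ! k) $ (is ! k))))"
    unfolding tensor_pairing_def list.size * add_Suc_right add_0_right
    by (subst sum.reindex)
       (auto simp: inj_on_def prod.lessThan_Suc_shift simp del: prod.lessThan_Suc intro!: sum.cong)
  also have "\<dots> = (\<Sum>j\<in>UNIV. v $ j * tensor_pairing (\<lambda>is. h (j # is)) vs)"
    unfolding tensor_pairing_def sum.cartesian_product[symmetric]
    by (simp add: sum_distrib_left mult_ac)
  finally show ?thesis .
qed

lemma tensor_pairing_Cons_axis:
  fixes h :: "'n::finite tensor"
  shows "tensor_pairing h (axis j 1 # vs) = tensor_pairing (\<lambda>is. h (j # is)) vs"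
  by (simp add: tensor_pairing_Cons axis_def if_distrib if_distribR cong: if_cong)

lemma tensor_pairing_diff:
  "tensor_pairing (\<lambda>is. h is - h' is) ys = tensor_pairing h ys - tensor_pairing h' ys"
  by (simp add: tensor_pairing_def left_diff_distrib sum_subtractf)

lemma tensor_pairing_Cons_linear:
  "tensor_pairing h ((a *\<^sub>R u + b *\<^sub>R v) # ys) = a * tensor_pairing h (u # ys) + b * tensor_pairing h (v # ys)"
  by (simp add: tensor_pairing_Cons sum_distrib_left sum.distrib algebra_simps)

lemma tensor_pairing_swap:
  assumes "perm_invariant h"
  shows "tensor_pairing h (u # v # ys) = tensor_pairing h (v # u # ys)"
proof -
  have "(\<lambda>is. h (i # j # is)) = (\<lambda>is. h (j # i # is))" for i j
    using assms by (auto simp: perm_invariant_def fun_eq_iff add_mset_commute)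
  then show ?thesis
    unfolding tensor_pairing_Cons sum_distrib_left
    by (subst sum.swap) (simp add: mult_ac)
qed

lemma tensor_pairing_replicate_shift:
  "perm_invariant h \<Longrightarrow>
     tensor_pairing h (v # replicate i u @ ys) = tensor_pairing h (replicate i u @ v # ys)"
proof (induction i arbitrary: h)
  case (Suc i)
  then show ?case
    by (simp add: tensor_pairing_swap[OF Suc.prems, of v])
       (simp add: tensor_pairing_Cons[of h u] Suc.IH perm_invariant_Cons)
qed simp

lemma tensor_pairing_replicate_commute:
  "perm_invariant h \<Longrightarrow>
     tensor_pairing h (replicate i u @ replicate j v) = tensor_pairing h (replicate j v @ replicate i u)"
proof (induction j arbitrary: h)
  case (Suc j)
  have "tensor_pairing h (replicate i u @ replicate (Suc j) v) = tensor_pairing h (v # replicate i u @ replicate j v)"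
    by (simp add: tensor_pairing_replicate_shift[OF Suc.prems])
  also have "\<dots> = tensor_pairing h (v # replicate j v @ replicate i u)"
    unfolding tensor_pairing_Cons[of h v] by (simp add: Suc.IH perm_invariant_Cons Suc.prems)
  finally show ?case by simp
qed simp

text \<open>The prefix \<open>ys\<close> is what allows the derivative of \<open>\<langle>h, \<theta>\<^sup>i k\<^bsup>n\<^esup>\<rangle>\<close> in \<open>k\<close> to be read off from this
  expansion.\<close>

lemma tensor_pairing_binomial:
  assumes "perm_invariant h"
  shows "tensor_pairing h (ys @ replicate n (a *\<^sub>R u + b *\<^sub>R v)) =
    (\<Sum>r\<le>n. real (n choose r) * a ^ r * b ^ (n - r) * tensor_pairing h (ys @ replicate r u @ replicate (n - r) v))"
  using assms
proof (induction ys arbitrary: h)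
  case (Cons y ys)
  then show ?case
    unfolding append_Cons tensor_pairing_Cons[of h y]
    by (subst (1) sum.swap[symmetric] | simp add: perm_invariant_Cons sum_distrib_left mult_ac sum.swap[of _ UNIV])+
next
  case Nil
  show ?case using Nil
  proof (induction n arbitrary: h)
    case (Suc n)
    let ?w = "a *\<^sub>R u + b *\<^sub>R v"
    let ?P = "\<lambda>i j. tensor_pairing h (replicate i u @ replicate j v)"
    have shift: "tensor_pairing h (v # replicate r u @ replicate j v) = ?P r (Suc j)" for r j
      using tensor_pairing_replicate_shift[OF Suc.prems] by simp
    have "tensor_pairing h (x # replicate n ?w) =
        (\<Sum>r\<le>n. real (n choose r) * a ^ r * b ^ (n - r) * tensor_pairing h (x # replicate r u @ replicate (n - r) v))" for x
      using Suc.IH[OF perm_invariant_Cons[OF Suc.prems]]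
      by (simp add: tensor_pairing_Cons[of h x] sum_distrib_left mult_ac sum.swap[of _ UNIV])
    then have "tensor_pairing h (replicate (Suc n) ?w) =
        a * (\<Sum>r\<le>n. real (n choose r) * a ^ r * b ^ (n - r) * ?P (Suc r) (n - r)) +
        b * (\<Sum>r\<le>n. real (n choose r) * a ^ r * b ^ (n - r) * ?P r (Suc n - r))"
      by (auto simp add: tensor_pairing_Cons_linear shift Suc_diff_le intro!: arg_cong2[where f = "(+)"] sum.cong)
    also have "a * (\<Sum>r\<le>n. real (n choose r) * a ^ r * b ^ (n - r) * ?P (Suc r) (n - r)) =
        (\<Sum>r\<le>n. real (n choose r) * a ^ Suc r * b ^ (n - r) * ?P (Suc r) (n - r))"
      by (simp add: sum_distrib_left mult_ac)
    also have "b * (\<Sum>r\<le>n. real (n choose r) * a ^ r * b ^ (n - r) * ?P r (Suc n - r)) =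
        (\<Sum>r\<le>Suc n. real (n choose r) * a ^ r * b ^ (Suc n - r) * ?P r (Suc n - r))"
      by (simp add: sum_distrib_left mult_ac Suc_diff_le binomial_eq_0)
    also have "\<dots> = b ^ Suc n * ?P 0 (Suc n) +
        (\<Sum>r\<le>n. real (n choose Suc r) * a ^ Suc r * b ^ (n - r) * ?P (Suc r) (n - r))"
      by (subst sum.atMost_Suc_shift) simp
    also have "(\<Sum>r\<le>n. real (n choose r) * a ^ Suc r * b ^ (n - r) * ?P (Suc r) (n - r)) + \<dots> =
        (\<Sum>r\<le>Suc n. real (Suc n choose r) * a ^ r * b ^ (Suc n - r) * ?P r (Suc n - r))"
      by (subst (1) sum.atMost_Suc_shift)
         (simp add: sum.distrib[symmetric] algebra_simps)
    finally show ?case by simp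
  qed simp
qed

text \<open>Polarization. The coefficient of \<open>s\<close> in \<open>\<langle>h, (s e\<^sub>j + v)\<^sup>m\<rangle>\<close> is \<open>m\<close> times the diagonal value of the
  contraction of \<open>h\<close> with \<open>e\<^sub>j\<close>, a tensor of order \<open>m - 1\<close>.\<close>

lemma tensor_zero_if_diagonal_zero:
  fixes h :: "'n::finite tensor"
  assumes "perm_invariant h" and "\<And>v. tensor_pairing h (replicate (length is) v) = 0"
  shows "h is = 0"
  using assms
proof (induction "is" arbitrary: h)
  case Nil
  then show ?case by simp
next
  case (Cons j js)
  let ?n = "length js"
  have "tensor_pairing (\<lambda>is. h (j # is)) (replicate ?n v) = 0" for v
  proof -
    let ?c = "\<lambda>r. real (Suc ?n choose r) * tensor_pairing h (replicate r (axis j 1) @ replicate (Suc ?n - r) v)"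
    have "(\<Sum>r\<le>Suc ?n. ?c r * s ^ r) = 0" for s :: real
      using Cons.prems(2)[of "s *\<^sub>R axis j 1 + 1 *\<^sub>R v"]
        tensor_pairing_binomial[OF Cons.prems(1), of "[]" "Suc ?n" s "axis j 1" 1 v]
      by (simp add: mult_ac del: sum.atMost_Suc)
    then have "?c 1 = 0"
      using polyfun_eq_0[of ?c "Suc ?n"] by (auto simp del: sum.atMost_Suc binomial_Suc_Suc)
    then show ?thesis
      by (simp add: tensor_pairing_Cons_axis)
  qed
  then show ?case
    using Cons.IH[OF perm_invariant_Cons[OF Cons.prems(1)]] by simp
qed

lemma continuous_on_tensor_pairing:
  fixes u v :: "'a::topological_space \<Rightarrow> real ^ 'n::finite"
  assumes h: "\<And>is. continuous_on S (\<lambda>x. h x is)" and u: "continuous_on S u" and v: "continuous_on S v"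
  shows "continuous_on S (\<lambda>x. tensor_pairing (h x) (replicate l (u x) @ replicate n (v x)))"
proof -
  have "continuous_on S (\<lambda>x. (replicate l (u x) @ replicate n (v x)) ! k $ i)" if "k < l + n" for k i
    using that u v by (cases "k < l") (auto simp: nth_append intro!: continuous_intros)
  then show ?thesis
    unfolding tensor_pairing_def length_append length_replicate
    by (intro continuous_on_sum continuous_on_mult h continuous_on_prod) auto
qed

text \<open>The Taylor expansion at \<open>\<tau>\<^sub>0\<close> is the binomial formula, and its linear coefficient is the derivative.\<close>

lemma tensor_pairing_has_derivative:
  assumes "perm_invariant h"
  shows "((\<lambda>\<tau>. tensor_pairing h (ys @ replicate n (k + \<tau> *\<^sub>R \<theta>))) has_real_derivative
      real n * tensor_pairing h (ys @ \<theta> # replicate (n - 1) (k + \<tau>\<^sub>0 *\<^sub>R \<theta>))) (at \<tau>\<^sub>0)"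
proof -
  define k0 where "k0 = k + \<tau>\<^sub>0 *\<^sub>R \<theta>"
  define a where "a r = real (n choose r) * tensor_pairing h (ys @ replicate r \<theta> @ replicate (n - r) k0)" for r
  have expand: "tensor_pairing h (ys @ replicate n (k + \<tau> *\<^sub>R \<theta>)) = (\<Sum>r\<le>n. a r * (\<tau> - \<tau>\<^sub>0) ^ r)" for \<tau>
    using tensor_pairing_binomial[OF assms, of ys n "\<tau> - \<tau>\<^sub>0" \<theta> 1 k0]
    by (simp add: k0_def a_def algebra_simps)
  have "((\<lambda>\<tau>. \<Sum>r\<le>n. a r * (\<tau> - \<tau>\<^sub>0) ^ r) has_real_derivative (\<Sum>r\<le>n. a r * (real r * 0 ^ (r - 1)))) (at \<tau>\<^sub>0)"
    by (auto intro!: derivative_eq_intros sum.cong simp: mult_ac)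
  moreover have "(\<Sum>r\<le>n. a r * (real r * 0 ^ (r - 1))) = real n * tensor_pairing h (ys @ \<theta> # replicate (n - 1) k0)"
  proof (cases n)
    case (Suc n')
    have "a r * (real r * 0 ^ (r - 1)) = 0" if "r \<noteq> 1" for r
      using that by (cases "r = 0") auto
    then have "(\<Sum>r\<le>n. a r * (real r * 0 ^ (r - 1))) = a 1"
      using Suc by (subst sum.remove[of _ 1]) (auto intro!: sum.neutral)
    then show ?thesis by (simp add: a_def)
  qed simp
  ultimately show ?thesis
    unfolding expand k0_def by simp
qed

section \<open>Integrals over Euclidean space\<close>

text \<open>Continuous integrands that vanish off a box are where the Lebesgue integral, used for Fubini's theorem,
  and the gauge integral, used for parameter dependence, can be exchanged freely.\<close>

lemma lborel_integral_cbox: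
  fixes f :: "'a::euclidean_space \<Rightarrow> real"
  assumes "continuous_on UNIV f" "\<And>x. x \<notin> cbox a b \<Longrightarrow> f x = 0"
  shows "integrable lborel f" and "(LINT x|lborel. f x) = integral (cbox a b) f"
proof -
  have "(\<lambda>x. indicator (cbox a b) x *\<^sub>R f x) = f"
    using assms(2) by (auto simp: fun_eq_iff indicator_def)
  then show i: "integrable lborel f"
    using borel_integrable_compact[of "cbox a b" f] continuous_on_subset[OF assms(1)] by auto
  have ext: "(\<lambda>x. if x \<in> cbox a b then f x else 0) = f"
    using assms(2) by auto
  have "(LINT x|lborel. f x) = integral UNIV f"
    using has_integral_integral_lborel[OF i] by (simp add: integral_unique)
  also have "\<dots> = integral (cbox a b) f"
    using integral_restrict_UNIV[of "cbox a b" f] unfolding ext .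
  finally show "(LINT x|lborel. f x) = integral (cbox a b) f" .
qed

lemma continuous_on_section:
  assumes "continuous_on UNIV (\<lambda>(s, x). F s x)"
  shows "continuous_on UNIV (F s)"
proof -
  have "continuous_on UNIV (\<lambda>x. (s, x))"
    by (intro continuous_intros)
  from continuous_on_compose2[OF assms this] show ?thesis by simp
qed

lemma lborel_integral_has_derivative_param:
  fixes F :: "real \<Rightarrow> 'a::euclidean_space \<Rightarrow> real"
  assumes F: "continuous_on UNIV (\<lambda>(s, x). F s x)" and F': "continuous_on UNIV (\<lambda>(s, x). F' s x)"
    and deriv: "\<And>s x. ((\<lambda>s. F s x) has_real_derivative F' s x) (at s)"
    and zero: "\<And>s x. x \<notin> cbox a b \<Longrightarrow> F s x = 0" "\<And>s x. x \<notin> cbox a b \<Longrightarrow> F' s x = 0"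
  shows "((\<lambda>s. LINT x|lborel. F s x) has_real_derivative (LINT x|lborel. F' s x)) (at s)"
proof -
  have c: "continuous_on UNIV (F s)" "continuous_on UNIV (F' s)" for s
    using continuous_on_section[OF F] continuous_on_section[OF F'] by auto
  have "((\<lambda>s. integral (cbox a b) (F s)) has_real_derivative integral (cbox a b) (F' s)) (at s within UNIV)"
    by (rule leibniz_rule_field_derivative)
       (auto intro!: deriv integrable_continuous continuous_on_subset[OF c(1)] continuous_on_subset[OF F'])
  then show ?thesis
    by (simp add: lborel_integral_cbox(2)[OF c(1) zero(1)] lborel_integral_cbox(2)[OF c(2) zero(2)])
qed

lemma lborel_integral_continuous_param:
  fixes F :: "'b::topological_space \<Rightarrow> 'a::euclidean_space \<Rightarrow> real"
  assumes F: "continuous_on UNIV (\<lambda>(s, x). F s x)" and zero: "\<And>s x. x \<notin> cbox a b \<Longrightarrow> F s x = 0"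
  shows "continuous_on UNIV (\<lambda>s. LINT x|lborel. F s x)"
proof -
  have c: "continuous_on UNIV (F s)" for s
    using continuous_on_section[OF F] by auto
  have "continuous_on UNIV (\<lambda>s. integral (cbox a b) (F s))"
    by (rule integral_continuous_on_param) (rule continuous_on_subset[OF F], simp)
  then show ?thesis
    by (simp add: lborel_integral_cbox(2)[OF c zero])
qed

text \<open>Integration by parts; boundary terms vanish because of the compact support.\<close>

lemma lborel_integral_parts_exp:
  fixes G :: "nat \<Rightarrow> real \<Rightarrow> real"
  assumes cont: "\<And>n. continuous_on UNIV (G n)" and supp: "\<And>n z. \<bar>z\<bar> > c \<Longrightarrow> G n z = 0"
    and deriv: "\<And>n z. (G n has_real_derivative G (Suc n) z) (at z)"
  shows "(LINT z|lborel. exp (b + k * z) * G n z) = (- k) ^ n * (LINT z|lborel. exp (b + k * z) * G 0 z)"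
proof (induction n)
  case (Suc n)
  define r where "r = \<bar>c\<bar> + 1"
  have r: "r > 0" "\<And>z n. z \<notin> {- r<..<r} \<Longrightarrow> G n z = 0"
    using supp by (auto simp: r_def intro!: supp)
  have E: "continuous_on UNIV (\<lambda>z. exp (b + k * z) * G n z)" for n
    by (intro continuous_intros cont)
  have Z: "exp (b + k * z) * G n z = 0" if "z \<notin> cbox (- r) r" for z n
    using that r by auto
  have I: "(LINT z|lborel. exp (b + k * z) * G n z) = integral {- r..r} (\<lambda>z. exp (b + k * z) * G n z)" for n
    using lborel_integral_cbox(2)[OF E Z] by simp
  have "((\<lambda>z. k * (exp (b + k * z) * G n z) + exp (b + k * z) * G (Suc n) z) has_integral
      exp (b + k * r) * G n r - exp (b + k * (- r)) * G n (- r)) {- r..r}"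
    by (rule fundamental_theorem_of_calculus)
       (use r(1) in \<open>auto intro!: derivative_eq_intros deriv[THEN DERIV_subset]
          simp flip: has_real_derivative_iff_has_vector_derivative\<close>)
  then have "integral {- r..r} (\<lambda>z. k * (exp (b + k * z) * G n z) + exp (b + k * z) * G (Suc n) z) = 0"
    using r by (simp add: integral_unique)
  then have "k * integral {- r..r} (\<lambda>z. exp (b + k * z) * G n z) + integral {- r..r} (\<lambda>z. exp (b + k * z) * G (Suc n) z) = 0"
    by (subst (asm) Henstock_Kurzweil_Integration.integral_add)
       (auto intro!: integrable_continuous_interval continuous_on_subset[OF E] continuous_intros continuous_on_subset[OF cont])
  then show ?case
    using Suc I[of n] I[of "Suc n"] by (simp add: algebra_simps)
qed simp

lemma AE_lborel_obtains_open:
  fixes U :: "'a::euclidean_space set"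
  assumes "AE x in lborel. P x" "open U" "U \<noteq> {}"
  shows "\<exists>x\<in>U. P x"
proof (rule ccontr)
  assume "\<not> (\<exists>x\<in>U. P x)"
  with assms(1) have "AE x in lborel. x \<notin> U"
    by (auto elim: AE_mp)
  then have "U \<in> null_sets lborel"
    using assms(2) by (subst AE_iff_null_sets) auto
  then have "negligible U"
    by (simp add: negligible_iff_null_sets null_sets_completionI)
  then show False
    using assms open_not_negligible by blast
qed

lemma continuous_zero_on_dense:
  fixes \<phi> :: "'a::topological_space \<Rightarrow> real"
  assumes "continuous_on UNIV \<phi>" and dense: "\<And>U. open U \<Longrightarrow> U \<noteq> {} \<Longrightarrow> \<exists>x\<in>U. \<phi> x = 0"
  shows "\<phi> x = 0"
proof (rule ccontr)
  assume "\<phi> x \<noteq> 0"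
  moreover have "open {x. \<phi> x \<noteq> 0}"
    by (intro open_Collect_neq assms(1) continuous_on_const)
  ultimately show False using dense[of "{x. \<phi> x \<noteq> 0}"] by blast
qed

lemma open_Int_nonhorizontal:
  fixes U :: "(real ^ 3) set"
  assumes "open U" "U \<noteq> {}"
  shows "open (U \<inter> {x. x $ 3 \<noteq> 0})" "U \<inter> {x. x $ 3 \<noteq> 0} \<noteq> {}"
proof -
  show "open (U \<inter> {x. x $ 3 \<noteq> 0})"
    by (intro open_Int assms open_Collect_neq continuous_intros)
  have "negligible {x :: real ^ 3. x $ 3 = 0}"
    using negligible_hyperplane[of "axis 3 1 :: real ^ 3" 0] by (simp add: inner_axis' axis_eq_0_iff)
  moreover have "\<not> negligible U"
    using assms open_not_negligible by blast
  ultimately show "U \<inter> {x. x $ 3 \<noteq> 0} \<noteq> {}"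
    using negligible_subset by blast
qed

text \<open>Let \<open>V\<close> be the set of all functions with the assumed properties of \<open>\<phi>\<close>, and consider the
  continuous \<open>g\<close> for which multiplication by \<open>g\<close> maps \<open>V\<close> to itself. They form an
  algebra containing the exponentials, which separate points. Hence they approximate \<open>\<phi>\<close>
  uniformly on the box, while \<open>\<integral> g \<phi> = 0\<close> for each of them, and so \<open>\<integral> \<phi>\<^sup>2 = 0\<close>.\<close>

lemma laplace_transform_injective:
  fixes \<phi> :: "'a::euclidean_space \<Rightarrow> real"
  assumes c: "continuous_on UNIV \<phi>" and z: "\<And>x. x \<notin> cbox a b \<Longrightarrow> \<phi> x = 0"
    and laplace: "\<And>k. (LINT x|lborel. exp (k \<bullet> x) * \<phi> x) = 0"
  shows "\<phi> x = 0"
proof -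
  define V where "V = {\<psi>. continuous_on UNIV \<psi> \<and> (\<forall>x. x \<notin> cbox a b \<longrightarrow> \<psi> x = 0) \<and>
      (\<forall>k. (LINT x|lborel. exp (k \<bullet> x) * \<psi> x) = 0)}"
  define P where "P g \<longleftrightarrow> continuous_on UNIV g \<and> (\<forall>\<psi>\<in>V. (\<lambda>x. g x * \<psi> x) \<in> V)" for g :: "'a \<Rightarrow> real"
  have intV: "integrable lborel (\<lambda>x. exp (k \<bullet> x) * \<psi> x)" if "\<psi> \<in> V" for k \<psi>
    by (rule lborel_integral_cbox(1)[of _ a b]) (use that in \<open>auto simp: V_def intro!: continuous_intros\<close>)
  have const: "P (\<lambda>_. r)" for r
    unfolding P_def V_def
    by (auto intro!: continuous_intros simp: mult.left_commute[of _ r])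
  have add: "P (\<lambda>x. f x + g x)" if "P f \<and> P g" for f g
  proof -
    have "(\<lambda>x. (f x + g x) * \<psi> x) \<in> V" if \<psi>: "\<psi> \<in> V" for \<psi>
    proof -
      have fg: "(\<lambda>x. f x * \<psi> x) \<in> V" "(\<lambda>x. g x * \<psi> x) \<in> V"
        using \<open>P f \<and> P g\<close> \<psi> by (auto simp: P_def)
      have "(LINT x|lborel. exp (k \<bullet> x) * ((f x + g x) * \<psi> x)) = 0" for k
        using intV[OF fg(1), of k] intV[OF fg(2), of k] fg
        by (simp add: V_def algebra_simps)
      then show ?thesis
        using fg \<open>P f \<and> P g\<close> \<psi> by (auto simp: V_def P_def intro!: continuous_intros)
    qed
    then show ?thesis
      using that by (auto simp: P_def intro!: continuous_intros)
  qed
  have mult: "P (\<lambda>x. f x * g x)" if "P f \<and> P g" for f g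
    using that by (auto simp: P_def mult.assoc intro!: continuous_intros)
  have exp: "P (\<lambda>x. exp (k \<bullet> x))" for k
    unfolding P_def V_def
    by (auto intro!: continuous_intros simp: mult.assoc[symmetric] exp_add[symmetric] inner_add_left[symmetric])
  have \<phi>: "\<phi> \<in> V" using c z laplace by (auto simp: V_def)
  have approx: "\<exists>g. P g \<and> (\<forall>x\<in>cbox a b. \<bar>\<phi> x - g x\<bar> < e)" if "e > 0" for e
  proof (rule Stone_Weierstrass_HOL[where P = P])
    show "continuous_on (cbox a b) g" if "P g" for g
      using that continuous_on_subset by (auto simp: P_def)
    show "\<exists>g. P g \<and> g x \<noteq> g y" if "x \<in> cbox a b \<and> y \<in> cbox a b \<and> x \<noteq> y" for x y
    proof (intro exI conjI)
      show "P (\<lambda>z. exp ((x - y) \<bullet> z))" by (rule exp)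
      have "(x - y) \<bullet> (x - y) > 0" using that by simp
      then show "exp ((x - y) \<bullet> x) \<noteq> exp ((x - y) \<bullet> y)"
        by (simp add: inner_diff_right)
    qed
  qed (use const add mult that continuous_on_subset[OF c] in auto)
  have i\<phi>: "integrable lborel (\<lambda>x. \<bar>\<phi> x\<bar>)" and i2: "integrable lborel (\<lambda>x. \<phi> x * \<phi> x)"
    by (rule lborel_integral_cbox(1)[of _ a b]; use c z in \<open>auto intro!: continuous_intros\<close>)+
  have bound: "(LINT x|lborel. \<phi> x * \<phi> x) \<le> e * (LINT x|lborel. \<bar>\<phi> x\<bar>)" if e: "e > 0" for e
  proof -
    obtain g where g: "P g" "\<And>x. x \<in> cbox a b \<Longrightarrow> \<bar>\<phi> x - g x\<bar> < e"
      using approx[OF e] by blast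
    have gV: "(\<lambda>x. g x * \<phi> x) \<in> V" using g \<phi> by (auto simp: P_def)
    then have g0: "(LINT x|lborel. g x * \<phi> x) = 0" "integrable lborel (\<lambda>x. g x * \<phi> x)"
      using intV[OF gV, of 0] by (auto simp: V_def dest: spec[of _ 0])
    have "(LINT x|lborel. \<phi> x * \<phi> x) = (LINT x|lborel. (\<phi> x * \<phi> x - g x * \<phi> x))"
      using g0 i2 by simp
    also have "\<dots> \<le> (LINT x|lborel. e * \<bar>\<phi> x\<bar>)"
    proof (rule integral_mono)
      show "\<phi> x * \<phi> x - g x * \<phi> x \<le> e * \<bar>\<phi> x\<bar>" for x
      proof (cases "x \<in> cbox a b")
        case True
        have "\<phi> x * \<phi> x - g x * \<phi> x \<le> \<bar>\<phi> x - g x\<bar> * \<bar>\<phi> x\<bar>"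
          unfolding abs_mult[symmetric] by (simp add: left_diff_distrib)
        also have "\<dots> \<le> e * \<bar>\<phi> x\<bar>"
          using g(2)[OF True] by (intro mult_right_mono) auto
        finally show ?thesis .
      qed (use z in simp)
    qed (use g0 i2 i\<phi> in auto)
    finally show ?thesis by simp
  qed
  have "(LINT x|lborel. \<phi> x * \<phi> x) \<le> 0"
  proof (rule field_le_epsilon)
    fix e :: real assume e: "e > 0"
    let ?I = "LINT x|lborel. \<bar>\<phi> x\<bar>"
    have I: "?I \<ge> 0" by simp
    have "e / (?I + 1) * ?I \<le> e"
      using e I by (simp add: divide_le_eq mult_left_mono distrib_left add_nonneg_pos)
    moreover have "(LINT x|lborel. \<phi> x * \<phi> x) \<le> e / (?I + 1) * ?I"
      using I e by (intro bound) (simp add: add_nonneg_pos)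
    ultimately show "(LINT x|lborel. \<phi> x * \<phi> x) \<le> 0 + e"
      by linarith
  qed
  moreover have "(LINT x|lborel. \<phi> x * \<phi> x) \<ge> 0" by simp
  ultimately have "AE x in lborel. \<phi> x * \<phi> x = 0"
    using integral_nonneg_eq_0_iff_AE[OF i2] by simp
  moreover have "open {x. \<phi> x \<noteq> 0}"
    by (intro open_Collect_neq c continuous_on_const)
  ultimately have "{x. \<phi> x \<noteq> 0} = {}"
    using AE_lborel_obtains_open[of "\<lambda>x. \<phi> x * \<phi> x = 0" "{x. \<phi> x \<noteq> 0}"] by auto
  then show ?thesis by auto
qed
section \<open>Distinct points of the curve on almost every plane\<close>

definition symmetrized_product :: "nat \<Rightarrow> (nat \<Rightarrow> 'a::euclidean_space) \<Rightarrow> 'a list \<Rightarrow> real" where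
  "symmetrized_product m a ys = (\<Sum>\<pi> | \<pi> permutes {..<m}. \<Prod>i<m. a i \<bullet> (ys ! \<pi> i))"

lemma symmetric_form_on_symmetrized_product:
  "symmetric_form_on m V (symmetrized_product m a)"
  unfolding symmetric_form_on_def
proof (intro conjI allI impI; elim conjE)
  fix ys :: "'a list" and k u v b c
  assume len: "length ys = m" and k: "k < m"
  have slot: "(\<Prod>i<m. a i \<bullet> (ys[k := b *\<^sub>R u + c *\<^sub>R v] ! \<pi> i)) =
      b * (\<Prod>i<m. a i \<bullet> (ys[k := u] ! \<pi> i)) + c * (\<Prod>i<m. a i \<bullet> (ys[k := v] ! \<pi> i))"
    if \<pi>: "\<pi> permutes {..<m}" for \<pi>
  proof -
    obtain i0 where i0: "i0 < m" "\<pi> i0 = k"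
      using k \<pi> by (metis imageE lessThan_iff permutes_image)
    have "\<pi> i \<noteq> k" if "i \<in> {..<m} - {i0}" for i
      using that i0 \<pi> by (metis permutes_inj injD Diff_iff singletonI)
    then have "ys[k := w] ! \<pi> i = ys ! \<pi> i" if "i \<in> {..<m} - {i0}" for i w
      using that by (metis nth_list_update_neq)
    then have "(\<Prod>i<m. a i \<bullet> (ys[k := w] ! \<pi> i)) = (a i0 \<bullet> w) * (\<Prod>i\<in>{..<m} - {i0}. a i \<bullet> (ys ! \<pi> i))" for w
      using i0 k len by (subst prod.remove[of _ i0]) (auto intro!: prod.cong)
    then show ?thesis
      by (simp add: inner_add_right algebra_simps)
  qed
  show "symmetrized_product m a (ys[k := b *\<^sub>R u + c *\<^sub>R v]) =
      b * symmetrized_product m a (ys[k := u]) + c * symmetrized_product m a (ys[k := v])"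
    unfolding symmetrized_product_def by (simp add: slot sum.distrib sum_distrib_left)
next
  fix ys zs :: "'a list"
  assume len: "length ys = m" and "mset ys = mset zs"
  then have lz: "length zs = m"
    by (metis size_mset)
  obtain \<sigma> where \<sigma>: "\<sigma> permutes {..<m}" "permute_list \<sigma> zs = ys"
    using mset_eq_permutation[OF \<open>mset ys = mset zs\<close>] lz by auto
  have nth: "ys ! (\<pi> i) = zs ! ((\<sigma> \<circ> \<pi>) i)" if "\<pi> permutes {..<m}" "i < m" for \<pi> i
    using that \<sigma> lz permutes_in_image[OF that(1), of i] by (auto simp: permute_list_nth)
  have "symmetrized_product m a ys = (\<Sum>\<pi> | \<pi> permutes {..<m}. \<Prod>i<m. a i \<bullet> (zs ! ((\<sigma> \<circ> \<pi>) i)))"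
    unfolding symmetrized_product_def by (intro sum.cong prod.cong refl) (simp add: nth)
  also have "\<dots> = symmetrized_product m a zs"
    unfolding symmetrized_product_def
    by (rule sum.reindex_bij_witness[where i = "\<lambda>\<pi>. inv \<sigma> \<circ> \<pi>" and j = "\<lambda>\<pi>. \<sigma> \<circ> \<pi>"])
       (use \<sigma> in \<open>auto simp: permutes_compose permutes_inv o_assoc[symmetric] permutes_inv_o
          intro!: permutes_compose permutes_inv\<close>,
        (simp add: o_assoc permutes_inv_o)+)
  finally show "symmetrized_product m a ys = symmetrized_product m a zs" .
qed

lemma symmetrized_product_replicate:
  "symmetrized_product m a (replicate m e) = fact m * (\<Prod>i<m. a i \<bullet> e)"
proof -
  have "(\<Prod>i<m. a i \<bullet> (replicate m e ! \<pi> i)) = (\<Prod>i<m. a i \<bullet> e)" if "\<pi> permutes {..<m}" for \<pi>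
    using permutes_in_image[OF that] by (intro prod.cong) auto
  then show ?thesis
    by (simp add: symmetrized_product_def card_permutations)
qed

lemma subspace_not_finite_Union_hyperplanes:
  fixes V :: "'a::euclidean_space set" and a :: "'i \<Rightarrow> 'a"
  assumes "finite I" "subspace V" "\<And>i. i \<in> I \<Longrightarrow> \<exists>z\<in>V. a i \<bullet> z \<noteq> 0"
  shows "\<exists>y\<in>V. \<forall>i\<in>I. a i \<bullet> y \<noteq> 0"
  using assms(1,3)
proof (induction I rule: finite_induct)
  case empty
  then show ?case using subspace_0[OF assms(2)] by auto
next
  case (insert i I)
  then obtain y z where y: "y \<in> V" "\<And>j. j \<in> I \<Longrightarrow> a j \<bullet> y \<noteq> 0" and z: "z \<in> V" "a i \<bullet> z \<noteq> 0"
    by (metis insert_iff)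
  define bad where "bad j = {t::real. a j \<bullet> (y + t *\<^sub>R z) = 0}" for j
  have "finite (bad j)" if "j \<in> insert i I" for j
  proof (cases "a j \<bullet> z = 0")
    case True
    then have "bad j = {}"
      using that y z by (auto simp: bad_def inner_add_right)
    then show ?thesis by simp
  next
    case False
    then have "bad j \<subseteq> {- (a j \<bullet> y) / (a j \<bullet> z)}"
      by (auto simp: bad_def inner_add_right field_simps)
    then show ?thesis
      using finite_subset by blast
  qed
  then have "finite (\<Union>j\<in>insert i I. bad j)"
    using insert.hyps by blast
  then obtain t where "t \<notin> (\<Union>j\<in>insert i I. bad j)"
    using ex_new_if_finite infinite_UNIV_char_0 by blast
  then show ?case
    by (intro bexI[of _ "y + t *\<^sub>R z"]) (auto simp: bad_def assms(2) y z subspace_add subspace_scale)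
qed

text \<open>If \<open>e j = e k\<close>, then \<open>m\<close> linear forms suffice to kill all \<open>e\<^sub>1, \<dots>, e\<^sub>N\<close>. Their
  symmetrized product is a form of order \<open>m\<close> that is zero on every \<open>e\<^sub>l\<^sup>m\<close> but not identically
  zero on \<open>V\<close>, so it cannot be told from the form \<open>0\<close>.\<close>

lemma generic_vectors_distinct:
  fixes V :: "'a::euclidean_space set"
  assumes V: "subspace V" "2 \<le> dim V" and gen: "generic_vectors m V N e" and N: "N \<le> Suc m"
  shows "inj_on e {1..N}"
proof (rule ccontr)
  assume "\<not> inj_on e {1..N}"
  then obtain j k where jk: "j \<in> {1..N}" "k \<in> {1..N}" "j \<noteq> k" "e j = e k"
    by (auto simp: inj_on_def)
  have "card ({1..N} - {k}) \<le> m"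
    using N jk by (simp add: card_Diff_singleton)
  then obtain \<beta> where \<beta>: "\<beta> ` ({1..N} - {k}) \<subseteq> {..<m}" "inj_on \<beta> ({1..N} - {k})"
    using card_le_inj[of "{1..N} - {k}" "{..<m}"] by auto
  have "\<exists>a. a \<bullet> w = 0 \<and> (\<exists>z\<in>V. a \<bullet> z \<noteq> 0)" for w
  proof -
    have "\<not> V \<subseteq> span {w}"
    proof
      assume "V \<subseteq> span {w}"
      then have "dim V \<le> card {w}"
        by (intro dim_le_card) auto
      with V show False by simp
    qed
    then obtain z where z: "z \<in> V" "z \<notin> span {w}" by blast
    define a where "a = z - ((z \<bullet> w) / (w \<bullet> w)) *\<^sub>R w"
    have "a \<bullet> w = 0" by (simp add: a_def inner_diff_left)
    moreover have "a \<noteq> 0"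
      using z(2) by (metis a_def right_minus_eq span_base span_scale singletonI)
    moreover have "a \<bullet> z = a \<bullet> a"
      using \<open>a \<bullet> w = 0\<close> by (simp add: a_def inner_diff_right)
    ultimately show ?thesis using z by (metis inner_eq_zero_iff)
  qed
  then obtain A where A: "\<And>w. A w \<bullet> w = 0" "\<And>w. \<exists>z\<in>V. A w \<bullet> z \<noteq> 0"
    by metis
  define \<beta>' where "\<beta>' = inv_into ({1..N} - {k}) \<beta>"
  define a where "a i = A (e (\<beta>' i))" for i
  have inv: "\<beta>' (\<beta> l) = l" if "l \<in> {1..N} - {k}" for l
    using that \<beta> by (simp add: \<beta>'_def)
  obtain y where y: "y \<in> V" "\<And>i. i < m \<Longrightarrow> a i \<bullet> y \<noteq> 0"
    using subspace_not_finite_Union_hyperplanes[of "{..<m}" V a] V A by (auto simp: a_def)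
  have zero: "symmetrized_product m a (replicate m (e l)) = 0" if l: "l \<in> {1..N}" for l
  proof -
    \<comment> \<open>The form chosen for \<open>e j\<close> also kills \<open>e k\<close>, which has no form of its own.\<close>
    define l' where "l' = (if l = k then j else l)"
    have "l' \<in> {1..N} - {k}" "e l' = e l"
      using l jk by (auto simp: l'_def)
    then have "\<beta> l' < m" "a (\<beta> l') \<bullet> e l = 0"
      using \<beta>(1) A(1)[of "e l"] inv[of l'] by (blast, simp add: a_def)
    then show ?thesis
      by (auto simp: symmetrized_product_replicate prod_zero_iff)
  qed
  have "symmetric_form_on m V (\<lambda>_. 0)"
    by (simp add: symmetric_form_on_def)
  moreover have "length (replicate m y) = m" "set (replicate m y) \<subseteq> V"
    using y(1) by auto
  ultimately have "symmetrized_product m a (replicate m y) = (\<lambda>_. 0) (replicate m y)"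
    using gen zero symmetric_form_on_symmetrized_product[of m V a]
    unfolding generic_vectors_def by blast
  then show False
    using y by (auto simp: symmetrized_product_replicate prod_zero_iff)
qed

lemma AE_lborel_scale:
  assumes "AE p in lborel. P p" "(c::real) \<noteq> 0"
  shows "AE p in lborel. P (c * p)"
proof -
  obtain N where N: "{x. \<not> P x} \<subseteq> N" "N \<in> null_sets lborel"
    using assms(1) by (auto elim!: AE_E simp: null_sets_def)
  have "AE p in lborel. 0 + c * p \<notin> N"
    by (rule AE_borel_affine) (use N AE_not_in assms(2) in auto)
  then show ?thesis
    using N(1) by (auto elim: AE_mp)
qed

text \<open>Surface measure on the sphere is defined by cones, so null sets of directions correspond to null cones.\<close>

lemma AE_sphere_measure_lborel:
  fixes P :: "'a::euclidean_space \<Rightarrow> bool"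
  assumes "AE \<omega> in sphere_measure. P \<omega>"
  shows "AE x in lborel. x \<in> ball 0 1 \<longrightarrow> P (sgn x)"
proof -
  have m[measurable]: "sgn \<in> measurable (restrict_space lborel (ball (0::'a) 1)) borel"
    by (rule measurable_restrict_space1) simp
  obtain N where N: "{x. \<not> P x} \<subseteq> N" "emeasure sphere_measure N = 0" "N \<in> sets sphere_measure"
    using assms by (auto elim!: AE_E simp: sphere_measure_def space_scale_measure)
  then have "N \<in> null_sets (distr (restrict_space lborel (ball 0 1)) borel sgn)"
    by (auto simp: sphere_measure_def null_sets_def)
  then have "AE x in distr (restrict_space lborel (ball 0 1)) borel sgn. P x"
    using N(1) by (auto intro: AE_I')
  from AE_distrD[OF m this] show ?thesis
    by (subst (asm) AE_restrict_space_iff) auto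
qed

lemma sigma_finite_sphere_measure: "sigma_finite_measure (sphere_measure :: 'a::euclidean_space measure)"
proof -
  have m: "sgn \<in> measurable (restrict_space lborel (ball (0::'a) 1)) borel"
    by (rule measurable_restrict_space1) simp
  have "emeasure (sphere_measure :: 'a measure) UNIV = of_nat DIM('a) * emeasure lborel (ball (0::'a) 1)"
    by (simp add: sphere_measure_def emeasure_distr[OF m] emeasure_restrict_space space_restrict_space)
  also have "\<dots> < \<infinity>"
    using emeasure_lborel_ball_finite by (auto simp: ennreal_mult_less_top of_nat_less_top)
  finally have "finite_measure (sphere_measure :: 'a measure)"
    by (intro finite_measureI) (simp add: sphere_measure_def space_scale_measure)
  then show ?thesis
    by (simp add: finite_measure_def)
qed

lemma hyperplane_scale: "norm x > 0 \<Longrightarrow> hyperplane (sgn x) (inverse (norm x) * p) = hyperplane x p"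
  by (auto simp: hyperplane_def sgn_div_norm field_simps)

text \<open>Almost every direction turns into a dense set of normals \<open>\<omega>\<close> of arbitrary norm, because rescaling
  \<open>\<omega>\<close> and \<open>p\<close> together does not change the plane. Such \<open>\<omega>\<close> later serve as arguments of the Laplace transform.\<close>

lemma kirillov_tuy_distinct_points:
  fixes B \<gamma> :: "(real ^ 3) set"
  assumes KT: "kirillov_tuy m B \<gamma>" and B: "open B" and U: "open U" "U \<noteq> {}"
  shows "\<exists>\<omega>\<in>U. \<omega> \<noteq> 0 \<and> (AE p in lborel. hyperplane \<omega> p \<inter> B \<noteq> {} \<longrightarrow>
           (\<exists>c. inj_on c {..m} \<and> c ` {..m} \<subseteq> hyperplane \<omega> p \<inter> \<gamma>))"
proof -
  define Q where "Q \<omega> p \<longleftrightarrow> (hyperplane \<omega> p \<inter> B \<noteq> {} \<longrightarrow>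
      (\<exists>c. inj_on c {..m} \<and> c ` {..m} \<subseteq> hyperplane \<omega> p \<inter> \<gamma>))" for \<omega> p
  interpret S: sigma_finite_measure "sphere_measure :: (real ^ 3) measure"
    by (rule sigma_finite_sphere_measure)
  interpret pair_sigma_finite "sphere_measure :: (real ^ 3) measure" "lborel :: real measure" ..
  have "AE (\<omega>, p) in sphere_measure \<Otimes>\<^sub>M lborel. norm \<omega> = 1 \<longrightarrow> Q \<omega> p"
    using KT unfolding kirillov_tuy_def
  proof (rule AE_mp, intro AE_I2, clarify)
    fix \<omega> :: "real ^ 3" and p :: real
    assume *: "hyperplane \<omega> p \<inter> B \<noteq> {} \<longrightarrow>
        (\<exists>W G. open W \<and> (\<omega>, p) \<in> W \<and>
           (\<forall>k\<in>{1..nu m DIM(real^3)}. smooth_on W (G k) \<and>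
              (\<forall>(\<omega>', p')\<in>W. norm \<omega>' = 1 \<longrightarrow> G k (\<omega>', p') \<in> hyperplane \<omega>' p' \<inter> \<gamma>)) \<and>
           (AE x in hyperplane_measure \<omega> p. x \<in> B \<longrightarrow>
              generic_vectors m (hyperplane \<omega> 0) (nu m DIM(real^3)) (\<lambda>k. x - G k (\<omega>, p))))"
      and n: "norm \<omega> = 1"
    have nu: "nu m DIM(real^3) = Suc m"
      by (simp add: nu_def binomial_symmetric[of m "Suc m"])
    have "\<omega> \<noteq> 0" using n by auto
    have ww: "\<omega> \<bullet> \<omega> = 1"
      using n by (simp add: norm_eq_1)
    show "Q \<omega> p"
      unfolding Q_def
    proof
      assume ne: "hyperplane \<omega> p \<inter> B \<noteq> {}"
      then obtain G where G: "\<And>k. k \<in> {1..Suc m} \<Longrightarrow> G k (\<omega>, p) \<in> hyperplane \<omega> p \<inter> \<gamma>"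
        and gen: "AE x in hyperplane_measure \<omega> p. x \<in> B \<longrightarrow>
              generic_vectors m (hyperplane \<omega> 0) (Suc m) (\<lambda>k. x - G k (\<omega>, p))"
        using * n unfolding nu by blast
      define \<pi> where "\<pi> x = x - (\<omega> \<bullet> x - p) *\<^sub>R \<omega>" for x
      have cont: "continuous_on UNIV \<pi>"
        unfolding \<pi>_def by (intro continuous_intros)
      then have "\<pi> \<in> measurable (restrict_space lborel {x. p \<le> \<omega> \<bullet> x \<and> \<omega> \<bullet> x \<le> p + 1}) borel"
        by (intro measurable_restrict_space1) (simp add: borel_measurable_continuous_onI)
      from AE_distrD[OF this, folded \<pi>_def] gen
      have "AE y in lborel. p \<le> \<omega> \<bullet> y \<and> \<omega> \<bullet> y \<le> p + 1 \<longrightarrow> \<pi> y \<in> B \<longrightarrow>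
          generic_vectors m (hyperplane \<omega> 0) (Suc m) (\<lambda>k. \<pi> y - G k (\<omega>, p))"
        unfolding hyperplane_measure_def \<pi>_def[symmetric]
        by (subst (asm) AE_restrict_space_iff) (auto simp: \<pi>_def[abs_def])
      moreover have "open ({y. p < \<omega> \<bullet> y} \<inter> {y. \<omega> \<bullet> y < p + 1} \<inter> \<pi> -` B)"
        using B cont by (intro open_Int open_vimage open_Collect_less continuous_intros) auto
      \<comment> \<open>The cylinder over \<open>B \<inter> hyperplane \<omega> p\<close> of heights between \<open>0\<close> and \<open>1\<close> is open and nonempty, hence not null.\<close>
      moreover obtain x0 where "x0 \<in> B" "\<omega> \<bullet> x0 = p"
        using ne by (auto simp: hyperplane_def)
      then have "x0 + (1/2) *\<^sub>R \<omega> \<in> {y. p < \<omega> \<bullet> y} \<inter> {y. \<omega> \<bullet> y < p + 1} \<inter> \<pi> -` B"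
        by (auto simp: inner_add_right ww \<pi>_def)
      ultimately obtain y where "generic_vectors m (hyperplane \<omega> 0) (Suc m) (\<lambda>k. \<pi> y - G k (\<omega>, p))"
        using AE_lborel_obtains_open by (smt (verit) IntD1 IntD2 empty_iff mem_Collect_eq vimageE)
      moreover have "subspace (hyperplane \<omega> 0)" "dim (hyperplane \<omega> 0) = 2"
        using dim_hyperplane[of \<omega>] \<open>\<omega> \<noteq> 0\<close> by (auto simp: hyperplane_def subspace_hyperplane)
      ultimately have "inj_on (\<lambda>k. \<pi> y - G k (\<omega>, p)) {1..Suc m}"
        using generic_vectors_distinct by (metis le_refl)
      then have "inj_on (\<lambda>k. G (Suc k) (\<omega>, p)) {..m}"
        by (force simp: inj_on_def)
      then show "\<exists>c. inj_on c {..m} \<and> c ` {..m} \<subseteq> hyperplane \<omega> p \<inter> \<gamma>"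
        using G by (intro exI[of _ "\<lambda>k. G (Suc k) (\<omega>, p)"]) (auto simp del: Int_iff)
    qed
  qed
  from AE_pair[OF this] have "AE \<omega> in sphere_measure. norm \<omega> = 1 \<longrightarrow> (AE p in lborel. Q \<omega> p)"
    by (auto elim!: AE_mp)
  from AE_sphere_measure_lborel[OF this]
  have ae: "AE x in lborel. x \<in> ball 0 1 - {0} \<longrightarrow> (AE p in lborel. Q (sgn x) p)"
    by (rule AE_mp) (auto simp: norm_sgn)
  obtain u where u: "u \<in> U" "u \<noteq> 0"
    using U not_open_singleton[of "0 :: real ^ 3"] by (metis ex_in_conv insertCI subset_singletonD subsetI)
  \<comment> \<open>Surface measure was transported to the unit ball, so \<open>U\<close> is shrunk until it meets the ball.\<close>
  define r where "r = norm u + 1"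
  have r: "r > 0" by (simp add: r_def add_nonneg_pos)
  have "open ((\<lambda>x. r *\<^sub>R x) -` U \<inter> (ball 0 1 - {0}))"
    by (intro open_Int open_vimage U open_Diff continuous_intros) auto
  moreover have "(1/r) *\<^sub>R u \<in> (\<lambda>x. r *\<^sub>R x) -` U \<inter> (ball 0 1 - {0})"
    using u r by (auto simp: r_def)
  ultimately obtain x where x: "r *\<^sub>R x \<in> U" "x \<noteq> 0" "AE p in lborel. Q (sgn x) p"
    using AE_lborel_obtains_open[OF ae] by blast
  let ?w = "r *\<^sub>R x"
  have "sgn ?w = sgn x" using r by (simp add: sgn_div_norm)
  moreover have "?w \<noteq> 0" using x r by simp
  ultimately have "AE p in lborel. Q (sgn ?w) (inverse (norm ?w) * p)"
    using AE_lborel_scale[OF x(3), of "inverse (norm ?w)"] by simp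
  moreover have "hyperplane (sgn ?w) (inverse (norm ?w) * p) = hyperplane ?w p" for p
    using \<open>?w \<noteq> 0\<close> by (intro hyperplane_scale) simp
  ultimately have "AE p in lborel. Q ?w p"
    unfolding Q_def by simp
  then show ?thesis
    using x(1) \<open>?w \<noteq> 0\<close> unfolding Q_def by blast
qed

section \<open>Ray data differentiated across a plane\<close>

text \<open>\<open>G n\<close> is the derivative of order \<open>n\<close> of \<open>G 0\<close> along \<open>d\<close>, and \<open>K\<close> contains all supports. The whole
  sequence is recorded because the proof differentiates \<open>m + 1\<close> times and later integrates by parts as often.\<close>

definition directional_jet :: "'a::euclidean_space set \<Rightarrow> 'a \<Rightarrow> (nat \<Rightarrow> 'a \<Rightarrow> real) \<Rightarrow> bool" where
  "directional_jet K d G \<longleftrightarrow>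
     (\<forall>n. continuous_on UNIV (G n)) \<and> (\<forall>n x. x \<notin> K \<longrightarrow> G n x = 0) \<and>
     (\<forall>n x. ((\<lambda>s. G n (x + s *\<^sub>R d)) has_real_derivative G (Suc n) x) (at 0))"

lemma
  assumes "directional_jet K d G"
  shows directional_jet_continuous: "continuous_on UNIV (G n)"
    and directional_jet_zero: "x \<notin> K \<Longrightarrow> G n x = 0"
    and directional_jet_deriv: "((\<lambda>s. G n (x + s *\<^sub>R d)) has_real_derivative G (Suc n) (x + s *\<^sub>R d)) (at s)"
proof -
  show "continuous_on UNIV (G n)" "x \<notin> K \<Longrightarrow> G n x = 0"
    using assms by (auto simp: directional_jet_def)
  have "((\<lambda>r. G n ((x + s *\<^sub>R d) + r *\<^sub>R d)) has_real_derivative G (Suc n) (x + s *\<^sub>R d)) (at 0)"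
    using assms by (auto simp: directional_jet_def)
  then show "((\<lambda>s. G n (x + s *\<^sub>R d)) has_real_derivative G (Suc n) (x + s *\<^sub>R d)) (at s)"
    using DERIV_shift[of "\<lambda>s. G n (x + s *\<^sub>R d)" "G (Suc n) (x + s *\<^sub>R d)" 0 s]
    by (simp add: algebra_simps)
qed

lemma directional_jet_cmult:
  "directional_jet K d G \<Longrightarrow> directional_jet K d (\<lambda>n x. G n x * c)"
  unfolding directional_jet_def by (auto intro!: continuous_intros DERIV_cmult_right)

lemma directional_jet_sum:
  assumes "\<And>i. i \<in> I \<Longrightarrow> directional_jet K d (G i)"
  shows "directional_jet K d (\<lambda>n x. \<Sum>i\<in>I. G i n x)"
  using assms unfolding directional_jet_def
  by (auto intro!: continuous_on_sum DERIV_sum sum.neutral)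

lemma directional_jet_scale:
  assumes "directional_jet K d G"
  shows "directional_jet K (c *\<^sub>R d) (\<lambda>n x. c ^ n * G n x)"
  unfolding directional_jet_def
proof (intro conjI allI impI)
  fix n x
  show "continuous_on UNIV (\<lambda>x. c ^ n * G n x)"
    by (intro continuous_intros directional_jet_continuous[OF assms])
  show "c ^ n * G n x = 0" if "x \<notin> K"
    using that by (simp add: directional_jet_zero[OF assms])
  have "((\<lambda>s. G n (x + (s * c) *\<^sub>R d)) has_real_derivative G (Suc n) x * c) (at 0)"
  proof -
    have "((\<lambda>s. s * c) has_real_derivative c) (at 0)"
      by (auto intro!: derivative_eq_intros)
    from DERIV_chain'[OF this, of "\<lambda>s. G n (x + s *\<^sub>R d)" "G (Suc n) x"] show ?thesis
      using directional_jet_deriv[OF assms, of n x 0] by simp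
  qed
  from DERIV_cmult[OF this, of "c ^ n"]
  show "((\<lambda>s. c ^ n * G n (x + s *\<^sub>R c *\<^sub>R d)) has_real_derivative c ^ Suc n * G (Suc n) x) (at 0)"
    by (simp add: mult_ac)
qed

lemma directional_jet_tensor_pairing:
  assumes "\<And>is. directional_jet K d (\<lambda>n x. H n x is)"
  shows "directional_jet K d (\<lambda>n x. tensor_pairing (H n x) ys)"
  unfolding tensor_pairing_def
  by (intro directional_jet_sum directional_jet_cmult assms)

lemma directional_jet_diff:
  assumes "directional_jet K d F" "directional_jet K d G"
  shows "directional_jet K d (\<lambda>n x. F n x - G n x)"
  using assms unfolding directional_jet_def by (auto intro!: continuous_intros DERIV_diff)

lemma smooth_on_directional_derivative:
  "smooth_on S f \<Longrightarrow> smooth_on S (\<lambda>x. frechet_derivative f (at x) v)"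
  unfolding smooth_on_def by (metis higher_differentiable_on.simps(2))

lemma smooth_on_directional_jet:
  fixes g :: "'a::euclidean_space \<Rightarrow> real"
  assumes "smooth_on UNIV g" and zero: "\<And>x. x \<notin> K \<Longrightarrow> g x = 0" and K: "closed K"
  shows "directional_jet K d (\<lambda>n. ((\<lambda>g x. frechet_derivative g (at x) d) ^^ n) g)"
proof -
  let ?D = "\<lambda>n. ((\<lambda>g x. frechet_derivative g (at x) d) ^^ n) g"
  have sm: "smooth_on UNIV (?D n)" for n
    by (induction n) (auto simp: assms(1) smooth_on_directional_derivative)
  have diff: "(?D n has_derivative frechet_derivative (?D n) (at x)) (at x)" for n x
    using sm[of n] unfolding smooth_on_def
    by (metis UNIV_I frechet_derivative_works higher_differentiable_on.simps(2))
  have "?D n x = 0" if "x \<notin> K" for n x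
    using that
  proof (induction n arbitrary: x)
    case (Suc n)
    have "((\<lambda>_. 0) has_derivative frechet_derivative (?D n) (at x)) (at x)"
      by (rule has_derivative_transform_within_open[OF diff, of "- K"])
         (use Suc K in \<open>auto simp: open_Compl\<close>)
    then have "frechet_derivative (?D n) (at x) = (\<lambda>_. 0)"
      using has_derivative_unique has_derivative_const by blast
    then show ?case by simp
  qed (use zero in simp)
  moreover have "continuous_on UNIV (?D n)" for n
    using sm[of n] unfolding smooth_on_def by (metis higher_differentiable_on.simps(1))
  moreover have "((\<lambda>s. ?D n (x + s *\<^sub>R d)) has_real_derivative ?D (Suc n) x) (at 0)" for n x
  proof -
    have "((\<lambda>s. x + s *\<^sub>R d) has_derivative (\<lambda>s. s *\<^sub>R d)) (at 0)"
      by (auto intro!: derivative_eq_intros)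
    then have "((\<lambda>s. ?D n (x + s *\<^sub>R d)) has_derivative (\<lambda>s. frechet_derivative (?D n) (at x) (s *\<^sub>R d))) (at 0)"
      using has_derivative_compose[of "\<lambda>s. x + s *\<^sub>R d" "\<lambda>s. s *\<^sub>R d" 0 UNIV "?D n"] diff[of n x] by simp
    moreover have "frechet_derivative (?D n) (at x) (s *\<^sub>R d) = ?D (Suc n) x * s" for s
      using linear_scale[OF has_derivative_linear[OF diff[of n x]], of s d] by simp
    ultimately show ?thesis
      by (simp add: has_field_derivative_def)
  qed
  ultimately show ?thesis
    unfolding directional_jet_def by blast
qed

text \<open>If \<open>F n\<close> is the derivative of order \<open>n\<close> of \<open>F 0\<close>, this is the derivative of order \<open>n\<close> of
  \<open>s\<^sup>k F 0 s\<close>, by repeated use of \<open>(s u)\<^bsup>(n)\<^esup> = s u\<^bsup>(n)\<^esup> + n u\<^bsup>(n - 1)\<^esup>\<close>.\<close>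

fun power_times_chain :: "(nat \<Rightarrow> real \<Rightarrow> real) \<Rightarrow> nat \<Rightarrow> nat \<Rightarrow> real \<Rightarrow> real" where
  "power_times_chain F 0 n s = F n s"
| "power_times_chain F (Suc k) n s =
     s * power_times_chain F k n s + real n * power_times_chain F k (n - 1) s"

lemma power_times_chain_has_derivative:
  assumes "\<And>n s. (F n has_real_derivative F (Suc n) s) (at s)"
  shows "(power_times_chain F k n has_real_derivative power_times_chain F k (Suc n) s) (at s)"
proof (induction k arbitrary: n s)
  case (Suc k)
  have "((\<lambda>s. real n * power_times_chain F k (n - 1) s) has_real_derivative real n * power_times_chain F k n s) (at s)"
    by (cases n) (auto intro!: derivative_eq_intros Suc)
  then have "((\<lambda>s. s * power_times_chain F k n s + real n * power_times_chain F k (n - 1) s)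
      has_real_derivative (1 * power_times_chain F k n s + power_times_chain F k (Suc n) s * s)
        + real n * power_times_chain F k n s) (at s)"
    by (intro DERIV_add DERIV_mult DERIV_ident Suc)
  then show ?case
    by (simp add: algebra_simps)
next
  case 0
  have "power_times_chain F 0 n = F n" for n by auto
  then show ?case using assms by simp
qed

lemma power_times_chain_0: "power_times_chain F k 0 s = s ^ k * F 0 s"
  by (induction k) auto

lemma power_times_chain_at_0:
  "power_times_chain F k (n + k) 0 = fact (n + k) / fact n * F n 0"
  by (induction k) (auto simp: algebra_simps)

text \<open>The sum is \<open>1 / (m + 1)!\<close> times the derivative of order \<open>m + 1\<close> at \<open>0\<close> of the vanishing function.\<close>

lemma leading_jet_relation:
  assumes chain: "\<And>l n s. (F l n has_real_derivative F l (Suc n) s) (at s)"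
    and zero: "\<And>s. (\<Sum>l\<le>m. b l * s ^ (m - l) * F l 0 s) = 0"
  shows "(\<Sum>l\<le>m. b l / fact (Suc l) * F l (Suc l) 0) = 0"
proof -
  define H where "H n s = (\<Sum>l\<le>m. b l * power_times_chain (F l) (m - l) n s)" for n s
  have deriv: "(H n has_real_derivative H (Suc n) s) (at s)" for n s
    unfolding H_def[abs_def]
    by (intro DERIV_sum DERIV_cmult power_times_chain_has_derivative chain)
  have H0: "H n s = 0" for n s
  proof (induction n arbitrary: s)
    case 0
    then show ?case using zero[of s] by (simp add: H_def power_times_chain_0 mult_ac)
  next
    case (Suc n)
    then have "H n = (\<lambda>_. 0)" by auto
    with deriv[of n s] show ?case
      using DERIV_unique[OF _ DERIV_const[of 0]] by metis
  qed
  have "power_times_chain (F l) (m - l) (Suc m) 0 = fact (Suc m) / fact (Suc l) * F l (Suc l) 0" if "l \<le> m" for l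
    using power_times_chain_at_0[of "F l" "m - l" "Suc l"] that by simp
  then have "H (Suc m) 0 = fact (Suc m) * (\<Sum>l\<le>m. b l / fact (Suc l) * F l (Suc l) 0)"
    by (simp add: H_def sum_distrib_left mult_ac del: fact_Suc)
  then show ?thesis using H0 by simp
qed

text \<open>The bound \<open>T\<close> is uniform over all directions normalized by \<open>w \<bullet> \<xi> = 1\<close>; this provides the common
  compact interval that differentiation under the integral along a moving ray requires.\<close>

lemma line_leaves_bounded:
  fixes K :: "'a::euclidean_space set"
  assumes "bounded K"
  obtains T where "\<And>\<xi> t. w \<bullet> \<xi> = 1 \<Longrightarrow> t \<notin> cbox (- T) T \<Longrightarrow> a + t *\<^sub>R \<xi> \<notin> K"
proof -
  obtain R where R: "\<And>x. x \<in> K \<Longrightarrow> norm x \<le> R"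
    using assms bounded_iff by blast
  define T where "T = norm w * R + \<bar>w \<bullet> a\<bar>"
  have "\<bar>t\<bar> \<le> T" if "w \<bullet> \<xi> = 1" "a + t *\<^sub>R \<xi> \<in> K" for \<xi> t
  proof -
    have "\<bar>w \<bullet> (a + t *\<^sub>R \<xi>)\<bar> \<le> norm w * R"
      using Cauchy_Schwarz_ineq2[of w "a + t *\<^sub>R \<xi>"] R[OF that(2)]
      by (meson mult_left_mono norm_ge_zero order_trans)
    then show ?thesis
      using that(1) by (simp add: T_def inner_add_right)
  qed
  then show ?thesis
    using that[of T] by (force simp: abs_le_iff)
qed

text \<open>A point with parameter \<open>t\<close> moves with velocity \<open>t d\<close> as the ray is tilted, whence one factor
  \<open>t\<close> per derivative.\<close>

lemma line_moment_chain:
  assumes jet: "directional_jet K d G" and K: "bounded K" and l: "w \<bullet> \<xi> = 1" "w \<bullet> d = 0"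
  shows "((\<lambda>s. LINT t|lborel. t ^ n * G n (a + t *\<^sub>R (\<xi> + s *\<^sub>R d))) has_real_derivative
     (LINT t|lborel. t ^ Suc n * G (Suc n) (a + t *\<^sub>R (\<xi> + s *\<^sub>R d)))) (at s)"
proof -
  obtain T where T: "\<And>\<xi> t. w \<bullet> \<xi> = 1 \<Longrightarrow> t \<notin> cbox (- T) T \<Longrightarrow> a + t *\<^sub>R \<xi> \<notin> K"
    using line_leaves_bounded[OF K, of w a] by blast
  have c: "continuous_on UNIV (\<lambda>(s, t). t ^ k * G n (a + t *\<^sub>R (\<xi> + s *\<^sub>R d)))" for n k
    unfolding case_prod_beta
    by (intro continuous_intros continuous_on_compose2[OF directional_jet_continuous[OF jet, of n]]) auto
  have z: "t ^ k * G n (a + t *\<^sub>R (\<xi> + s *\<^sub>R d)) = 0" if "t \<notin> cbox (- T) T" for n k s t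
    using T[of "\<xi> + s *\<^sub>R d" t] that l by (simp add: inner_add_right directional_jet_zero[OF jet])
  have d: "((\<lambda>s. t ^ n * G n (a + t *\<^sub>R (\<xi> + s *\<^sub>R d))) has_real_derivative
      t ^ Suc n * G (Suc n) (a + t *\<^sub>R (\<xi> + s *\<^sub>R d))) (at s)" for s t
  proof -
    have "((\<lambda>s. G n ((a + t *\<^sub>R \<xi>) + (s * t) *\<^sub>R d)) has_real_derivative
        G (Suc n) ((a + t *\<^sub>R \<xi>) + (s * t) *\<^sub>R d) * t) (at s)"
    proof -
      have "((\<lambda>s. s * t) has_real_derivative t) (at s)"
        by (auto intro!: derivative_eq_intros)
      from DERIV_chain'[OF this, of "\<lambda>s. G n ((a + t *\<^sub>R \<xi>) + s *\<^sub>R d)"] show ?thesis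
        using directional_jet_deriv[OF jet, of n "a + t *\<^sub>R \<xi>" "s * t"] by simp
    qed
    from DERIV_cmult[OF this, of "t ^ n"] show ?thesis
      by (simp add: algebra_simps)
  qed
  show ?thesis
    by (rule lborel_integral_has_derivative_param[OF c c d z z])
qed

lemma line_moment_integrable:
  assumes jet: "directional_jet K d G" and K: "bounded K" and l: "w \<bullet> \<xi> = 1"
  shows "integrable lborel (\<lambda>t. t ^ k * G n (a + t *\<^sub>R \<xi>))"
proof -
  obtain T where T: "\<And>\<xi> t. w \<bullet> \<xi> = 1 \<Longrightarrow> t \<notin> cbox (- T) T \<Longrightarrow> a + t *\<^sub>R \<xi> \<notin> K"
    using line_leaves_bounded[OF K, of w a] by blast
  show ?thesis
  proof (rule lborel_integral_cbox(1))
    show "continuous_on UNIV (\<lambda>t. t ^ k * G n (a + t *\<^sub>R \<xi>))"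
      by (intro continuous_intros continuous_on_compose2[OF directional_jet_continuous[OF jet, of n]]) auto
    show "t ^ k * G n (a + t *\<^sub>R \<xi>) = 0" if "t \<notin> cbox (- T) T" for t
      using T[of \<xi> t] that l by (simp add: directional_jet_zero[OF jet])
  qed
qed

text \<open>The vector \<open>s \<theta> - c \<omega>\<close> is expanded binomially; the power of \<open>s\<close> in front of each term decides how many
  of the \<open>m + 1\<close> derivatives fall on the tensor field.\<close>

lemma differentiated_ray_data:
  fixes H :: "nat \<Rightarrow> real ^ 'n::finite \<Rightarrow> 'n tensor" and \<theta> \<omega> d \<xi> w a :: "real ^ 'n" and m :: nat
  defines "G \<equiv> \<lambda>l n x. tensor_pairing (H n x) (replicate l \<omega> @ replicate (m - l) \<theta>)"
  assumes jet: "\<And>is. directional_jet K d (\<lambda>n x. H n x is)" and K: "bounded K"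
    and sym: "\<And>x. perm_invariant (H 0 x)"
    and l: "w \<bullet> \<xi> = 1" "w \<bullet> d = 0"
    and data: "\<And>s. (LINT t|lborel. tensor_pairing (H 0 (a + t *\<^sub>R (\<xi> + s *\<^sub>R d)))
                  (replicate m ((- c) *\<^sub>R \<omega> + s *\<^sub>R \<theta>))) = 0"
  shows "(\<Sum>l\<le>m. real (m choose l) * (- c) ^ l / fact (Suc l) *
           (LINT t|lborel. t ^ Suc l * G l (Suc l) (a + t *\<^sub>R \<xi>))) = 0"
proof -
  have jetG: "directional_jet K d (G l)" for l
    unfolding G_def by (rule directional_jet_tensor_pairing[OF jet])
  define F where "F l n s = (LINT t|lborel. t ^ n * G l n (a + t *\<^sub>R (\<xi> + s *\<^sub>R d)))" for l n s
  have "(\<Sum>l\<le>m. real (m choose l) * (- c) ^ l / fact (Suc l) * F l (Suc l) 0) = 0"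
  proof (rule leading_jet_relation)
    show "(F l n has_real_derivative F l (Suc n) s) (at s)" for l n s
      unfolding F_def by (rule line_moment_chain[OF jetG K l])
    show "(\<Sum>i\<le>m. real (m choose i) * (- c) ^ i * s ^ (m - i) * F i 0 s) = 0" for s
    proof -
      have "w \<bullet> (\<xi> + s *\<^sub>R d) = 1" using l by (simp add: inner_add_right)
      then have int: "integrable lborel (\<lambda>t. G i 0 (a + t *\<^sub>R (\<xi> + s *\<^sub>R d)))" for i
        using line_moment_integrable[OF jetG K, of w "\<xi> + s *\<^sub>R d" 0] by simp
      have expand: "tensor_pairing (H 0 x) (replicate m ((- c) *\<^sub>R \<omega> + s *\<^sub>R \<theta>)) =
          (\<Sum>i\<le>m. real (m choose i) * (- c) ^ i * s ^ (m - i) * G i 0 x)" for x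
        using tensor_pairing_binomial[OF sym, of x "[]" m "- c" \<omega> s \<theta>] by (simp only: append_Nil G_def)
      have "0 = (LINT t|lborel. (\<Sum>i\<le>m. real (m choose i) * (- c) ^ i * s ^ (m - i) * G i 0 (a + t *\<^sub>R (\<xi> + s *\<^sub>R d))))"
        using data[of s] by (simp only: expand)
      also have "\<dots> = (\<Sum>i\<le>m. real (m choose i) * (- c) ^ i * s ^ (m - i) * F i 0 s)"
        using int by (subst Bochner_Integration.integral_sum) (auto simp: F_def)
      finally show ?thesis by simp
    qed
  qed
  then show ?thesis by (simp add: F_def)
qed

section \<open>Transverse ray data in terms of orthogonal vectors\<close>

lemma continuous_on_vector3 [continuous_intros]:
  assumes "continuous_on S f" "continuous_on S g" "continuous_on S h"
  shows "continuous_on S (\<lambda>x. vector [f x, g x, h x] :: real ^ 3)"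
proof -
  have "continuous_on S (\<lambda>x. (vector [f x, g x, h x] :: real ^ 3) $ i)" for i
    using assms exhaust_3[of i] by auto
  then have "continuous_on S (\<lambda>x. \<chi> i. (vector [f x, g x, h x] :: real ^ 3) $ i)"
    by (rule continuous_on_vec_lambda)
  then show ?thesis by simp
qed

lemma inner_real3: "x \<bullet> y = x $ 1 * y $ 1 + x $ 2 * y $ 2 + x $ 3 * (y $ 3 :: real)" for x y :: "real ^ 3"
  by (simp add: inner_vec_def sum_3)

lemma field_support_zero: "x \<notin> field_support f \<Longrightarrow> f x is = 0"
  using closure_subset[of "{x. \<exists>is. f x is \<noteq> 0}"] unfolding field_support_def by auto

text \<open>The three vectors form an orthonormal basis.\<close>

lemma sph_frame_expansion:
  "\<eta> = (\<eta> \<bullet> sph_xi \<phi>\<^sub>1 \<phi>\<^sub>2) *\<^sub>R sph_xi \<phi>\<^sub>1 \<phi>\<^sub>2 + (\<eta> \<bullet> sph_alpha \<phi>\<^sub>1 \<phi>\<^sub>2) *\<^sub>R sph_alpha \<phi>\<^sub>1 \<phi>\<^sub>2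
     + (\<eta> \<bullet> sph_beta \<phi>\<^sub>1 \<phi>\<^sub>2) *\<^sub>R sph_beta \<phi>\<^sub>1 \<phi>\<^sub>2"
proof -
  have 1: "(sin \<phi>\<^sub>1)\<^sup>2 + (cos \<phi>\<^sub>1)\<^sup>2 = 1" and 2: "(sin \<phi>\<^sub>2)\<^sup>2 + (cos \<phi>\<^sub>2)\<^sup>2 = 1" by simp_all
  show ?thesis
    unfolding vec_eq_iff forall_3 inner_real3 vector_add_component vector_scaleR_component
      sph_xi_def sph_alpha_def sph_beta_def vector_3 real_scaleR_def
    using 1 2 by (intro conjI; algebra)
qed

lemma vanishing_transverse_data:
  fixes f g :: "real ^ 3 \<Rightarrow> 3 tensor"
  assumes ang: "angle_choice \<Phi>\<^sub>1 \<Phi>\<^sub>2"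
    and f: "smooth_compact_symmetric_field m f" and g: "smooth_compact_symmetric_field m g"
    and eq: "\<And>\<xi> i. \<xi> \<in> sphere 0 1 \<Longrightarrow> i \<le> m \<Longrightarrow>
           transverse_ray_transform \<Phi>\<^sub>1 \<Phi>\<^sub>2 m i f a \<xi> = transverse_ray_transform \<Phi>\<^sub>1 \<Phi>\<^sub>2 m i g a \<xi>"
    and \<xi>: "\<xi> \<noteq> 0" and \<eta>: "\<eta> \<bullet> \<xi> = 0"
  shows "(LINT t|lborel. tensor_pairing (\<lambda>is. f (a + t *\<^sub>R \<xi>) is - g (a + t *\<^sub>R \<xi>) is) (replicate m \<eta>)) = 0"
proof -
  have int: "integrable lborel (\<lambda>t. tensor_pairing (F (a + t *\<^sub>R \<zeta>)) ys)"
    if F: "smooth_compact_symmetric_field m F" and z: "norm \<zeta> = 1" for F :: "real ^ 3 \<Rightarrow> 3 tensor" and \<zeta> ys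
  proof -
    have "\<zeta> \<bullet> \<zeta> = 1" using z by (simp add: norm_eq_1)
    have "bounded (field_support F)"
      using F by (auto simp: smooth_compact_symmetric_field_def compact_imp_bounded)
    from line_leaves_bounded[OF this, of \<zeta> a] obtain T
      where T: "\<And>t. t \<notin> cbox (- T) T \<Longrightarrow> a + t *\<^sub>R \<zeta> \<notin> field_support F"
      using \<open>\<zeta> \<bullet> \<zeta> = 1\<close> by metis
    have c: "continuous_on UNIV (\<lambda>x. F x is)" for "is"
      using F unfolding smooth_compact_symmetric_field_def smooth_on_def
      by (metis higher_differentiable_on.simps(1))
    show ?thesis
    proof (rule lborel_integral_cbox(1))
      show "continuous_on UNIV (\<lambda>t. tensor_pairing (F (a + t *\<^sub>R \<zeta>)) ys)"
        unfolding tensor_pairing_def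
        by (intro continuous_intros continuous_on_compose2[OF c]) auto
      show "tensor_pairing (F (a + t *\<^sub>R \<zeta>)) ys = 0" if "t \<notin> cbox (- T) T" for t
      proof -
        have "F (a + t *\<^sub>R \<zeta>) is = 0" for "is"
          by (rule field_support_zero[OF T[OF that]])
        then show ?thesis by (simp add: tensor_pairing_def)
      qed
    qed
  qed
  define \<zeta> where "\<zeta> = sgn \<xi>"
  have z: "norm \<zeta> = 1" "\<zeta> \<in> sphere 0 1" "\<xi> = norm \<xi> *\<^sub>R \<zeta>"
    using \<xi> by (auto simp: \<zeta>_def norm_sgn sgn_div_norm)
  define \<alpha> \<beta> where "\<alpha> = sph_alpha (\<Phi>\<^sub>1 \<zeta>) (\<Phi>\<^sub>2 \<zeta>)" and "\<beta> = sph_beta (\<Phi>\<^sub>1 \<zeta>) (\<Phi>\<^sub>2 \<zeta>)"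
  have "\<zeta> = sph_xi (\<Phi>\<^sub>1 \<zeta>) (\<Phi>\<^sub>2 \<zeta>)"
    using ang z(2) unfolding angle_choice_def by blast
  moreover have "\<eta> \<bullet> \<zeta> = 0"
    using \<eta> by (simp add: \<zeta>_def sgn_div_norm)
  ultimately have \<eta>': "\<eta> = (\<eta> \<bullet> \<alpha>) *\<^sub>R \<alpha> + (\<eta> \<bullet> \<beta>) *\<^sub>R \<beta>"
    using sph_frame_expansion[of \<eta> "\<Phi>\<^sub>1 \<zeta>" "\<Phi>\<^sub>2 \<zeta>"] by (simp add: \<alpha>_def \<beta>_def)
  let ?D = "\<lambda>x is. f x is - g x is"
  have pi: "perm_invariant (?D x)" for x
    using f g unfolding smooth_compact_symmetric_field_def symmetric_tensor_def perm_invariant_def by metis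
  let ?P = "\<lambda>F i t. tensor_pairing (F (a + t *\<^sub>R \<zeta>)) (replicate i \<alpha> @ replicate (m - i) \<beta>)"
  have i0: "(LINT t|lborel. ?P ?D i t) = 0" "integrable lborel (?P ?D i)" if "i \<le> m" for i
    using eq[OF z(2) that] int[OF f z(1)] int[OF g z(1)]
    by (simp_all add: transverse_ray_transform_def tensor_pairing_diff \<alpha>_def \<beta>_def)
  have "(LINT t|lborel. tensor_pairing (?D (a + t *\<^sub>R \<zeta>)) (replicate m \<eta>)) =
      (LINT t|lborel. (\<Sum>i\<le>m. real (m choose i) * (\<eta> \<bullet> \<alpha>) ^ i * (\<eta> \<bullet> \<beta>) ^ (m - i) * ?P ?D i t))"
    using tensor_pairing_binomial[OF pi, of _ "[]" m "\<eta> \<bullet> \<alpha>" \<alpha> "\<eta> \<bullet> \<beta>" \<beta>] \<eta>' by simp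
  also have "\<dots> = 0"
    using i0 by (subst Bochner_Integration.integral_sum) auto
  finally have "(LINT t|lborel. tensor_pairing (?D (a + t *\<^sub>R \<zeta>)) (replicate m \<eta>)) = 0" .
  moreover have "norm \<xi> \<noteq> 0" using \<xi> by simp
  ultimately have "(LINT t|lborel. tensor_pairing (?D (a + (t * norm \<xi>) *\<^sub>R \<zeta>)) (replicate m \<eta>)) = 0"
    using lborel_integral_real_affine[of "norm \<xi>" "\<lambda>t. tensor_pairing (?D (a + t *\<^sub>R \<zeta>)) (replicate m \<eta>)" 0]
    by (simp add: mult.commute)
  moreover have "(t * norm \<xi>) *\<^sub>R \<zeta> = t *\<^sub>R \<xi>" for t
    by (subst z(3)) simp
  ultimately show ?thesis by simp
qed

section \<open>From rays to planes\<close>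

text \<open>Fubini's theorem in the coordinates \<open>x = a + t v\<close>, \<open>y = b + t\<close>, where \<open>\<bar>t\<bar>\<close> is the Jacobian. Only the
  line \<open>y = b\<close>, a null set, is missed.\<close>

lemma fan_beam_plane_integral:
  fixes \<phi> :: "real \<times> real \<Rightarrow> real"
  assumes cont: "continuous_on UNIV \<phi>" and supp: "\<And>z. z \<notin> cbox (- c, - c) (c, c) \<Longrightarrow> \<phi> z = 0"
    and rays: "\<And>v. (LINT t|lborel. \<bar>t\<bar> * \<phi> (a + t * v, b + t)) = 0"
  shows "(LINT z|lborel. \<phi> z) = 0"
proof -
  have int: "integrable lborel \<phi>"
    by (rule lborel_integral_cbox[OF cont supp])
  have meas[measurable]: "\<phi> \<in> borel_measurable (borel \<Otimes>\<^sub>M borel)"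
    using borel_measurable_continuous_onI[OF cont] by (simp add: borel_prod)
  have csec: "continuous_on UNIV (\<lambda>x. \<phi> (x, y))" for y
    by (rule continuous_on_compose2[OF cont]) (auto intro!: continuous_intros)
  have isec: "integrable lborel (\<lambda>x. \<phi> (x, y))" for y
    by (rule lborel_integral_cbox[OF csec, of "- c" c]) (auto intro!: supp)
  define F where "F = (\<lambda>(t, v). \<bar>t\<bar> * \<phi> (a + t * v, b + t))"
  have Fm[measurable]: "F \<in> borel_measurable (lborel \<Otimes>\<^sub>M lborel)"
    unfolding F_def by measurable
  have inner: "(LINT v|lborel. F (t, v)) = (LINT x|lborel. \<phi> (x, b + t))"
    "(LINT v|lborel. norm (F (t, v))) = (LINT x|lborel. norm (\<phi> (x, b + t)))"
    "integrable lborel (\<lambda>v. F (t, v))" if "t \<noteq> 0" for t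
    using lborel_integral_real_affine[OF that, of "\<lambda>x. \<phi> (x, b + t)" a]
      lborel_integral_real_affine[OF that, of "\<lambda>x. norm (\<phi> (x, b + t))" a]
      lborel_integrable_real_affine[OF isec[of "b + t"] that, of a]
    by (auto simp: F_def abs_mult)
  have intn: "integrable (lborel \<Otimes>\<^sub>M lborel) (\<lambda>z. norm (\<phi> z))"
    using int by (simp add: lborel_prod)
  have "integrable lborel (\<lambda>y. LINT x|lborel. norm (\<phi> (x, y)))"
    using lborel_pair.integrable_snd[of "\<lambda>x y. norm (\<phi> (x, y))"] intn by (simp add: case_prod_beta')
  then have "integrable lborel (\<lambda>t. LINT x|lborel. norm (\<phi> (x, b + t)))"
    using lborel_integrable_real_affine[of "\<lambda>y. LINT x|lborel. norm (\<phi> (x, y))" 1 b] by simp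
  moreover have ne: "AE t in lborel. t \<noteq> (0::real)"
    by (rule AE_lborel_singleton)
  then have "AE t in lborel. (LINT v|lborel. norm (F (t, v))) = (LINT x|lborel. norm (\<phi> (x, b + t)))"
    by (rule AE_mp) (simp add: inner del: real_norm_def)
  ultimately have "integrable lborel (\<lambda>t. LINT v|lborel. norm (F (t, v)))"
    by (subst integrable_cong_AE[where g = "\<lambda>t. LINT x|lborel. norm (\<phi> (x, b + t))"])
       (auto simp del: real_norm_def)
  moreover have "AE t in lborel. integrable lborel (\<lambda>v. F (t, v))"
    using ne by (rule AE_mp) (auto simp: inner)
  ultimately have "integrable (lborel \<Otimes>\<^sub>M lborel) F"
    by (intro lborel_pair.Fubini_integrable) auto
  then have "(LINT v|lborel. LINT t|lborel. F (t, v)) = (LINT t|lborel. LINT v|lborel. F (t, v))"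
    using lborel_pair.Fubini_integral[of "\<lambda>t v. F (t, v)"] by (simp add: case_prod_beta)
  also have "\<dots> = (LINT t|lborel. LINT x|lborel. \<phi> (x, b + t))"
    using ne by (intro integral_cong_AE, simp, simp, elim AE_mp) (auto simp: inner intro!: AE_I2)
  also have "\<dots> = (LINT y|lborel. LINT x|lborel. \<phi> (x, y))"
    using lborel_integral_real_affine[of 1 "\<lambda>y. LINT x|lborel. \<phi> (x, y)" b] by simp
  also have "\<dots> = (LINT z|lborel. \<phi> z)"
    using lborel_pair.integral_snd[of "\<lambda>x y. \<phi> (x, y)"] int by (simp add: case_prod_beta lborel_prod)
  finally show ?thesis
    using rays by (simp add: F_def)
qed

text \<open>The change of variables \<open>p = w1 x + w2 y + w3 z\<close> in the last coordinate.\<close>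

lemma integral_over_parallel_planes:
  fixes F :: "(real \<times> real) \<times> real \<Rightarrow> real"
  assumes cont: "continuous_on UNIV F" and supp: "\<And>q z. (q, z) \<notin> cbox (a, b) (a', b') \<Longrightarrow> F (q, z) = 0"
    and w3: "w3 \<noteq> 0"
  shows "(LINT p|lborel. LINT q|lborel. F (q, (p - w1 * fst q - w2 * snd q) / w3)) =
    \<bar>w3\<bar> * (LINT q|lborel. LINT z|lborel. F (q, z))"
proof -
  let ?G = "\<lambda>q p. F (q, (p - w1 * fst q - w2 * snd q) / w3)"
  have Gc: "continuous_on UNIV (\<lambda>(q, p). ?G q p)"
    unfolding case_prod_beta by (intro continuous_on_compose2[OF cont] continuous_intros) (use w3 in auto)
  have "bounded (cbox (a, b) (a', b'))"
    by (rule bounded_cbox)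
  then obtain c where c: "\<And>q z. (q, z) \<in> cbox (a, b) (a', b') \<Longrightarrow> norm (q, z) \<le> c"
    unfolding bounded_iff by blast
  define M where "M = (\<bar>w1\<bar> + \<bar>w2\<bar> + \<bar>w3\<bar>) * c"
  have M: "?G q p = 0" if "\<bar>p\<bar> > M" for q p
  proof (rule ccontr)
    define z where "z = (p - w1 * fst q - w2 * snd q) / w3"
    assume "?G q p \<noteq> 0"
    then have n: "norm (q, z) \<le> c" using supp c unfolding z_def by blast
    have "\<bar>fst q\<bar> \<le> c" "\<bar>snd q\<bar> \<le> c" "\<bar>z\<bar> \<le> c"
      using n norm_fst_le[of q z] norm_snd_le[of z q]
        norm_fst_le[of "fst q" "snd q"] norm_snd_le[of "snd q" "fst q"]
      unfolding real_norm_def prod.collapse by linarith+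
    then have "\<bar>w1 * fst q\<bar> \<le> \<bar>w1\<bar> * c" "\<bar>w2 * snd q\<bar> \<le> \<bar>w2\<bar> * c" "\<bar>w3 * z\<bar> \<le> \<bar>w3\<bar> * c"
      by (simp_all add: abs_mult mult_left_mono del: times_divide_eq_right)
    moreover have "p = w1 * fst q + w2 * snd q + w3 * z"
      using w3 by (simp add: z_def)
    ultimately have "\<bar>p\<bar> \<le> M"
      unfolding M_def distrib_right by linarith
    with that show False by simp
  qed
  have Gz: "(case z of (q, p) \<Rightarrow> ?G q p) = 0" if "z \<notin> cbox (a, - M) (a', M)" for z
    using that supp M by (cases z) (auto simp: cbox_Pair_eq not_le abs_le_iff)
  have int: "integrable (lborel \<Otimes>\<^sub>M lborel) (\<lambda>(q, p). ?G q p)"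
    unfolding lborel_prod by (rule lborel_integral_cbox[OF Gc Gz])
  have "(LINT p|lborel. LINT q|lborel. ?G q p) = (LINT q|lborel. LINT p|lborel. ?G q p)"
    by (rule lborel_pair.Fubini_integral[OF int])
  also have "\<dots> = (LINT q|lborel. \<bar>w3\<bar> * (LINT z|lborel. F (q, z)))"
    using lborel_integral_real_affine[OF w3, of "?G q" "w1 * fst q + w2 * snd q" for q] w3 by simp
  finally show ?thesis by simp
qed

text \<open>Planes with \<open>\<omega> $ 3 \<noteq> 0\<close> are graphs over the first two coordinates. Up to the constant factor
  \<open>norm \<omega> / \<bar>\<omega> $ 3\<bar>\<close>, Lebesgue measure in these coordinates is surface measure.\<close>

definition plane_point :: "real ^ 3 \<Rightarrow> real \<Rightarrow> real \<times> real \<Rightarrow> real ^ 3" where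
  "plane_point \<omega> p q = vector [fst q, snd q, (p - \<omega> $ 1 * fst q - \<omega> $ 2 * snd q) / \<omega> $ 3]"

text \<open>The direction \<open>\<xi> v\<close>, parallel to the plane, is normalized to have second component \<open>1\<close>, so that the rays sweep the
  plane in the coordinates of \<open>fan_beam_plane_integral\<close>.\<close>

lemma plane_identity:
  fixes H :: "nat \<Rightarrow> real ^ 3 \<Rightarrow> 3 tensor" and \<theta> \<omega> a :: "real ^ 3" and m :: nat
  defines "G \<equiv> \<lambda>l n x. tensor_pairing (H n x) (replicate l \<omega> @ replicate (m - l) \<theta>)"
  assumes jet: "\<And>is. directional_jet K ((1 / \<omega> $ 3) *\<^sub>R axis 3 1) (\<lambda>n x. H n x is)" and K: "bounded K"
    and sym: "\<And>x. perm_invariant (H 0 x)"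
    and w3: "\<omega> $ 3 \<noteq> 0" and th3: "\<theta> $ 3 = 0"
    and side: "\<And>\<xi>. \<xi> \<noteq> 0 \<Longrightarrow> (\<forall>t\<ge>0. a + t *\<^sub>R \<xi> \<notin> K) \<or> (\<forall>t\<le>0. a + t *\<^sub>R \<xi> \<notin> K)"
    and data: "\<And>\<xi> \<eta>. \<xi> \<noteq> 0 \<Longrightarrow> \<eta> \<bullet> \<xi> = 0 \<Longrightarrow>
        (LINT t|lborel. tensor_pairing (H 0 (a + t *\<^sub>R \<xi>)) (replicate m \<eta>)) = 0"
  shows "(LINT q|lborel. (\<Sum>l\<le>m. real (m choose l) / fact (Suc l) *
      (\<theta> \<bullet> a - \<theta> \<bullet> plane_point \<omega> (\<omega> \<bullet> a) q) ^ l * G l (Suc l) (plane_point \<omega> (\<omega> \<bullet> a) q))) = 0"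
proof -
  define d :: "real ^ 3" where "d = (1 / \<omega> $ 3) *\<^sub>R axis 3 1"
  define e2 :: "real ^ 3" where "e2 = axis 2 1"
  define \<xi> :: "real \<Rightarrow> real ^ 3" where "\<xi> v = vector [v, 1, - (\<omega> $ 1 * v + \<omega> $ 2) / \<omega> $ 3]" for v
  note jet' = jet[folded d_def]
  have jetG: "directional_jet K d (G l)" for l
    unfolding G_def by (rule directional_jet_tensor_pairing[OF jet'])
  have e2: "e2 \<bullet> \<xi> v = 1" "e2 \<bullet> d = 0" for v
    by (auto simp: e2_def d_def \<xi>_def inner_real3 axis_def)
  have dots: "\<omega> \<bullet> \<xi> v = 0" "\<omega> \<bullet> d = 1" "\<theta> \<bullet> d = 0" for v
    using w3 th3 by (auto simp: d_def \<xi>_def inner_real3 axis_def field_simps)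
  have nz: "\<xi> v + s *\<^sub>R d \<noteq> 0" for v s
    using e2(1)[of v] e2(2) by (metis add.right_neutral inner_add_right inner_scaleR_right inner_zero_right mult_zero_right zero_neq_one)
  let ?C = "\<lambda>l. real (m choose l) / fact (Suc l)"
  define \<phi> where "\<phi> q = (\<Sum>l\<le>m. ?C l *
      (\<theta> \<bullet> a - \<theta> \<bullet> plane_point \<omega> (\<omega> \<bullet> a) q) ^ l * G l (Suc l) (plane_point \<omega> (\<omega> \<bullet> a) q))" for q
  have cp: "continuous_on UNIV (plane_point \<omega> p)" for p
    unfolding plane_point_def[abs_def] by (intro continuous_intros) (use w3 in auto)
  have cont: "continuous_on UNIV \<phi>"
    unfolding \<phi>_def[abs_def]
    by (intro continuous_intros cp continuous_on_compose2[OF directional_jet_continuous[OF jetG] cp]) auto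
  obtain R where R: "\<And>x. x \<in> K \<Longrightarrow> norm x \<le> R"
    using K bounded_iff by blast
  have supp: "\<phi> q = 0" if "q \<notin> cbox (- R, - R) (R, R)" for q
  proof -
    let ?x = "plane_point \<omega> (\<omega> \<bullet> a) q"
    have "?x \<notin> K"
    proof
      assume "?x \<in> K"
      then have "\<bar>?x $ 1\<bar> \<le> R" "\<bar>?x $ 2\<bar> \<le> R"
        using R component_le_norm_cart order_trans by blast+
      with that show False
        by (cases q) (auto simp: plane_point_def cbox_Pair_eq abs_le_iff)
    qed
    then show ?thesis
      by (simp add: \<phi>_def directional_jet_zero[OF jetG])
  qed
  have "(LINT t|lborel. \<bar>t\<bar> * \<phi> (a $ 1 + t * v, a $ 2 + t)) = 0" for v
  proof -
    let ?c = "\<theta> \<bullet> \<xi> v"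
    have pt: "plane_point \<omega> (\<omega> \<bullet> a) (a $ 1 + t * v, a $ 2 + t) = a + t *\<^sub>R \<xi> v" for t
      using w3 by (simp add: plane_point_def \<xi>_def vec_eq_iff forall_3 inner_real3 field_simps)
    \<comment> \<open>The field vanishes on one of the two halves of the line, so \<open>\<bar>t\<bar>\<close> may be replaced by \<open>t\<close> or by \<open>- t\<close>.\<close>
    obtain \<epsilon> :: real where \<epsilon>: "\<And>l n t. \<bar>t\<bar> * G l n (a + t *\<^sub>R \<xi> v) = \<epsilon> * (t * G l n (a + t *\<^sub>R \<xi> v))"
    proof -
      have "\<xi> v \<noteq> 0" using nz[of v 0] by simp
      from side[OF this] show thesis
      proof
        assume *: "\<forall>t\<ge>0. a + t *\<^sub>R \<xi> v \<notin> K"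
        show thesis
          by (rule that[of "- 1"]) (use * in \<open>auto simp: abs_if directional_jet_zero[OF jetG]\<close>)
      next
        assume *: "\<forall>t\<le>0. a + t *\<^sub>R \<xi> v \<notin> K"
        show thesis
          by (rule that[of 1]) (use * in \<open>auto simp: abs_if directional_jet_zero[OF jetG]\<close>)
      qed
    qed
    have "\<bar>t\<bar> * \<phi> (a $ 1 + t * v, a $ 2 + t) =
        \<epsilon> * (\<Sum>l\<le>m. real (m choose l) * (- ?c) ^ l / fact (Suc l) * (t ^ Suc l * G l (Suc l) (a + t *\<^sub>R \<xi> v)))" for t
    proof -
      have "\<bar>t\<bar> * \<phi> (a $ 1 + t * v, a $ 2 + t) =
          (\<Sum>l\<le>m. ?C l * (- (t * ?c)) ^ l * (\<bar>t\<bar> * G l (Suc l) (a + t *\<^sub>R \<xi> v)))"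
        by (simp add: \<phi>_def pt inner_add_right sum_distrib_left mult_ac)
      also have "\<dots> = (\<Sum>l\<le>m. \<epsilon> * (real (m choose l) * (- ?c) ^ l / fact (Suc l) * (t ^ Suc l * G l (Suc l) (a + t *\<^sub>R \<xi> v))))"
        by (intro sum.cong refl) (simp add: \<epsilon> power_mult_distrib power_minus[of "t * _"] power_minus[of ?c] del: fact_Suc)
      finally show ?thesis by (simp only: sum_distrib_left)
    qed
    then have "(LINT t|lborel. \<bar>t\<bar> * \<phi> (a $ 1 + t * v, a $ 2 + t)) =
        \<epsilon> * (\<Sum>l\<le>m. real (m choose l) * (- ?c) ^ l / fact (Suc l) * (LINT t|lborel. t ^ Suc l * G l (Suc l) (a + t *\<^sub>R \<xi> v)))"
      using line_moment_integrable[OF jetG K e2(1)]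
      by (simp add: Bochner_Integration.integral_sum del: fact_Suc power_Suc)
    also have "\<dots> = 0"
    proof -
      have "(LINT t|lborel. tensor_pairing (H 0 (a + t *\<^sub>R (\<xi> v + s *\<^sub>R d))) (replicate m ((- ?c) *\<^sub>R \<omega> + s *\<^sub>R \<theta>))) = 0" for s
        by (rule data[OF nz]) (simp add: inner_add_left inner_add_right inner_diff_left dots)
      from differentiated_ray_data[OF jet' K sym e2 this] show ?thesis
        by (simp add: G_def del: fact_Suc power_Suc)
    qed
    finally show ?thesis .
  qed
  from fan_beam_plane_integral[OF cont supp this] show ?thesis
    by (simp add: \<phi>_def)
qed

section \<open>From planes to the Laplace transform\<close>

text \<open>Integrals over space are taken over triples of reals, where Fubini's theorem for product measures applies
  directly.\<close>

definition point_at :: "(real \<times> real) \<times> real \<Rightarrow> real ^ 3" where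
  "point_at x = vector [fst (fst x), snd (fst x), snd x]"

lemma continuous_on_point_at [continuous_intros]:
  "continuous_on S f \<Longrightarrow> continuous_on S (\<lambda>x. point_at (f x))"
  unfolding point_at_def by (intro continuous_intros)

lemma point_at_component_le: "norm (point_at x) \<le> R \<Longrightarrow> x \<in> cbox ((- R, - R), - R) ((R, R), R)"
  using component_le_norm_cart[of "point_at x" 1] component_le_norm_cart[of "point_at x" 2]
    component_le_norm_cart[of "point_at x" 3]
  by (cases x) (auto simp: point_at_def cbox_Pair_eq abs_le_iff)

text \<open>For fixed \<open>\<theta>\<close> the identity is a polynomial in \<open>\<theta> \<bullet> c k\<close> of degree at most \<open>m\<close>. If these \<open>m + 1\<close> numbers
  are distinct, then all coefficients vanish. They are distinct for almost every \<open>\<theta>\<close>, because distinct points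
  of a plane that is a graph have distinct projections; the coefficients are continuous in \<open>\<theta>\<close>, which
  gives the remaining \<open>\<theta>\<close>.\<close>

lemma plane_coefficients_vanish:
  fixes H :: "nat \<Rightarrow> real ^ 3 \<Rightarrow> 3 tensor" and \<theta> \<omega> :: "real ^ 3" and m :: nat
  defines "G \<equiv> \<lambda>\<theta> l n x. tensor_pairing (H n x) (replicate l \<omega> @ replicate (m - l) \<theta>)"
  assumes jet: "\<And>is. directional_jet K ((1 / \<omega> $ 3) *\<^sub>R axis 3 1) (\<lambda>n x. H n x is)" and K: "bounded K"
    and w3: "\<omega> $ 3 \<noteq> 0" and th3: "\<theta> $ 3 = 0" and j: "j \<le> m"
    and c: "inj_on c {..m}" "\<And>k. k \<le> m \<Longrightarrow> \<omega> \<bullet> c k = p"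
    and identity: "\<And>\<theta> k. \<theta> $ 3 = 0 \<Longrightarrow> k \<le> m \<Longrightarrow>
      (LINT q|lborel. (\<Sum>l\<le>m. real (m choose l) / fact (Suc l) *
        (\<theta> \<bullet> c k - \<theta> \<bullet> plane_point \<omega> p q) ^ l * G \<theta> l (Suc l) (plane_point \<omega> p q))) = 0"
  shows "(LINT q|lborel. (\<Sum>l\<le>m. real (m choose l) / fact (Suc l) * real (l choose j) *
      (- (\<theta> \<bullet> plane_point \<omega> p q)) ^ (l - j) * G \<theta> l (Suc l) (plane_point \<omega> p q))) = 0"
proof -
  define th :: "real \<times> real \<Rightarrow> real ^ 3" where "th r = vector [fst r, snd r, 0]" for r
  define \<Psi> where "\<Psi> j r q = (\<Sum>l\<le>m. real (m choose l) / fact (Suc l) * real (l choose j) *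
      (- (th r \<bullet> plane_point \<omega> p q)) ^ (l - j) * G (th r) l (Suc l) (plane_point \<omega> p q))" for j r q
  have jetG: "directional_jet K ((1 / \<omega> $ 3) *\<^sub>R axis 3 1) (G \<theta> l)" for \<theta> l
    unfolding G_def by (rule directional_jet_tensor_pairing[OF jet])
  have cp: "continuous_on S (\<lambda>x. plane_point \<omega> p (f x))" if "continuous_on S f"
    for f :: "(real \<times> real) \<times> (real \<times> real) \<Rightarrow> real \<times> real" and S
    unfolding plane_point_def by (intro continuous_intros that) (use w3 in auto)
  have cont: "continuous_on UNIV (\<lambda>(r, q). \<Psi> j r q)" for j
    unfolding \<Psi>_def G_def case_prod_beta th_def
    by (intro continuous_intros cp continuous_on_tensor_pairing
        continuous_on_compose2[OF directional_jet_continuous[OF jet] cp]) auto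
  obtain R where R: "\<And>x. x \<in> K \<Longrightarrow> norm x \<le> R"
    using K bounded_iff by blast
  have supp: "\<Psi> j r q = 0" if "q \<notin> cbox (- R, - R) (R, R)" for j r q
  proof -
    let ?x = "plane_point \<omega> p q"
    have "?x = point_at (q, ?x $ 3)"
      by (simp add: point_at_def plane_point_def)
    then have "?x \<notin> K"
      using that point_at_component_le[of "(q, ?x $ 3)" R] R by (metis cbox_Pair_eq mem_Sigma_iff)
    then show ?thesis
      by (simp add: \<Psi>_def directional_jet_zero[OF jetG])
  qed
  have int: "integrable lborel (\<Psi> j r)" for j r
    by (rule lborel_integral_cbox(1)[OF continuous_on_section[OF cont] supp])
  have good: "(LINT q|lborel. \<Psi> j r q) = 0" if inj: "inj_on (\<lambda>k. th r \<bullet> c k) {..m}" and j: "j \<le> m" for r j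
  proof (rule ccontr)
    assume nz: "(LINT q|lborel. \<Psi> j r q) \<noteq> 0"
    let ?Z = "{\<sigma>. (\<Sum>j\<le>m. (LINT q|lborel. \<Psi> j r q) * \<sigma> ^ j) = 0}"
    have "finite ?Z" "card ?Z \<le> m"
      using polyfun_rootbound[of m "\<lambda>j. LINT q|lborel. \<Psi> j r q"] nz j by auto
    moreover have "(\<lambda>k. th r \<bullet> c k) ` {..m} \<subseteq> ?Z"
    proof clarify
      fix k assume k: "k \<le> m"
      let ?\<sigma> = "th r \<bullet> c k"
      have exp: "(\<sigma> - y) ^ l = (\<Sum>j\<le>m. real (l choose j) * \<sigma> ^ j * (- y) ^ (l - j))" if "l \<le> m" for l and \<sigma> y :: real
      proof -
        have "(\<sigma> - y) ^ l = (\<Sum>j\<le>l. real (l choose j) * \<sigma> ^ j * (- y) ^ (l - j))"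
          using binomial_ring[of \<sigma> "- y" l] by simp
        also have "\<dots> = (\<Sum>j\<le>m. real (l choose j) * \<sigma> ^ j * (- y) ^ (l - j))"
          using that by (intro sum.mono_neutral_left) auto
        finally show ?thesis .
      qed
      have "(\<Sum>l\<le>m. real (m choose l) / fact (Suc l) * (?\<sigma> - th r \<bullet> plane_point \<omega> p q) ^ l *
          G (th r) l (Suc l) (plane_point \<omega> p q)) = (\<Sum>j\<le>m. \<Psi> j r q * ?\<sigma> ^ j)" for q
        unfolding \<Psi>_def sum_distrib_right
        by (subst sum.swap, intro sum.cong refl, subst exp)
           (simp_all add: sum_distrib_left sum_distrib_right mult_ac del: fact_Suc)
      then have "0 = (LINT q|lborel. (\<Sum>j\<le>m. \<Psi> j r q * ?\<sigma> ^ j))"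
        using identity[of "th r" k] k by (simp add: th_def del: fact_Suc)
      also have "\<dots> = (\<Sum>j\<le>m. (LINT q|lborel. \<Psi> j r q) * ?\<sigma> ^ j)"
        using int by (subst Bochner_Integration.integral_sum) auto
      finally show "(\<Sum>j\<le>m. (LINT q|lborel. \<Psi> j r q) * ?\<sigma> ^ j) = 0" by simp
    qed
    ultimately have "card ((\<lambda>k. th r \<bullet> c k) ` {..m}) \<le> m"
      using card_mono order_trans by blast
    then show False
      using card_image[OF inj] by simp
  qed
  \<comment> \<open>The projections of the points to the first two coordinates are distinct, so this is a finite union of lines.\<close>
  define bad where "bad = (\<Union>k\<in>{..m}. \<Union>k'\<in>{..m} - {k}. {r. (c k $ 1 - c k' $ 1, c k $ 2 - c k' $ 2) \<bullet> r = 0})"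
  have "negligible {r. (c k $ 1 - c k' $ 1, c k $ 2 - c k' $ 2) \<bullet> r = 0}"
    if k: "k \<in> {..m}" "k' \<in> {..m} - {k}" for k k'
  proof -
    have "(c k $ 1 - c k' $ 1, c k $ 2 - c k' $ 2) \<noteq> 0"
    proof
      assume "(c k $ 1 - c k' $ 1, c k $ 2 - c k' $ 2) = 0"
      then have e: "c k $ 1 = c k' $ 1" "c k $ 2 = c k' $ 2" by (auto simp: zero_prod_def)
      have "\<omega> \<bullet> c k = \<omega> \<bullet> c k'" using c(2) k by auto
      then have "c k $ 3 = c k' $ 3" using e w3 by (simp add: inner_real3)
      then have "c k = c k'" using e by (simp add: vec_eq_iff forall_3)
      with c(1) k show False by (auto simp: inj_on_def)
    qed
    then show ?thesis
      by (intro negligible_hyperplane) auto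
  qed
  then have "negligible bad"
    unfolding bad_def by (intro negligible_Union) (auto intro!: negligible_Union)
  have goodr: "(LINT q|lborel. \<Psi> j r q) = 0" if "r \<notin> bad" for r
  proof (rule good[OF _ j], rule inj_onI)
    fix k k' assume "k \<in> {..m}" "k' \<in> {..m}" "th r \<bullet> c k = th r \<bullet> c k'"
    with that show "k = k'"
      by (auto simp: bad_def th_def inner_real3 inner_prod_def algebra_simps)
  qed
  have "continuous_on UNIV (\<lambda>r. LINT q|lborel. \<Psi> j r q)"
    by (rule lborel_integral_continuous_param[OF cont supp])
  then have "open {r. (LINT q|lborel. \<Psi> j r q) \<noteq> 0}"
    by (intro open_Collect_neq continuous_intros)
  moreover have "negligible {r. (LINT q|lborel. \<Psi> j r q) \<noteq> 0}"
    by (rule negligible_subset[OF \<open>negligible bad\<close>]) (use goodr in blast)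
  ultimately have "(LINT q|lborel. \<Psi> j r q) = 0" for r
    using open_not_negligible by blast
  then have "(LINT q|lborel. \<Psi> j (\<theta> $ 1, \<theta> $ 2) q) = 0" .
  moreover have "th (\<theta> $ 1, \<theta> $ 2) = \<theta>"
    using th3 by (simp add: th_def vec_eq_iff forall_3)
  ultimately show ?thesis
    by (simp add: \<Psi>_def del: fact_Suc)
qed

text \<open>Integrating over all planes with weight \<open>e\<^sup>p\<close> gives an integral over space with weight
  \<open>e\<^bsup>\<omega> \<bullet> x\<^esup>\<close>. Moving \<open>l + 1\<close> derivatives along \<open>e\<^sub>3 / \<omega>\<^sub>3\<close> onto the exponential yields only a sign,
  since \<open>\<theta> \<bullet> x\<close> does not depend on the third coordinate.\<close>

lemma laplace_identity:
  fixes H :: "nat \<Rightarrow> real ^ 3 \<Rightarrow> 3 tensor" and \<theta> \<omega> :: "real ^ 3" and m :: nat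
  defines "G \<equiv> \<lambda>l n x. tensor_pairing (H n x) (replicate l \<omega> @ replicate (m - l) \<theta>)"
  assumes jet: "\<And>is. directional_jet K ((1 / \<omega> $ 3) *\<^sub>R axis 3 1) (\<lambda>n x. H n x is)" and K: "bounded K"
    and w3: "\<omega> $ 3 \<noteq> 0" and th3: "\<theta> $ 3 = 0"
    and planes: "AE p in lborel. (LINT q|lborel. (\<Sum>l\<le>m. real (m choose l) / fact (Suc l) * real (l choose j) *
      (- (\<theta> \<bullet> plane_point \<omega> p q)) ^ (l - j) * G l (Suc l) (plane_point \<omega> p q))) = 0"
  shows "(\<Sum>l\<le>m. real (m choose l) / fact (Suc l) * real (l choose j) *
      (LINT x|lborel. exp (\<omega> \<bullet> point_at x) * (\<theta> \<bullet> point_at x) ^ (l - j) * G l 0 (point_at x))) = 0"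
proof -
  have jetG: "directional_jet K ((1 / \<omega> $ 3) *\<^sub>R axis 3 1) (G l)" for l
    unfolding G_def by (rule directional_jet_tensor_pairing[OF jet])
  obtain R where R: "\<And>x. x \<in> K \<Longrightarrow> norm x \<le> R"
    using K bounded_iff by blast
  have Gz: "G l n (point_at x) = 0" if "x \<notin> cbox ((- R, - R), - R) ((R, R), R)" for l n x
    using that point_at_component_le[of x R] R directional_jet_zero[OF jetG] by blast
  have Gc: "continuous_on UNIV (\<lambda>x. G l n (point_at x))" for l n
    by (rule continuous_on_compose2[OF directional_jet_continuous[OF jetG]]) (auto intro!: continuous_intros)
  let ?b = "\<lambda>l. real (m choose l) / fact (Suc l) * real (l choose j)"
  define F where "F l n x = exp (\<omega> \<bullet> point_at x) * (- (\<theta> \<bullet> point_at x)) ^ (l - j) * G l n (point_at x)" for l n x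
  have Fc: "continuous_on UNIV (F l n)" for l n
    unfolding F_def[abs_def] by (intro continuous_intros Gc)
  have Fz: "F l n x = 0" if "x \<notin> cbox ((- R, - R), - R) ((R, R), R)" for l n x
    using Gz[OF that] by (simp add: F_def)
  have Fi: "integrable lborel (F l n)" for l n
    by (rule lborel_integral_cbox(1)[OF Fc Fz])
  have Ffub: "(LINT q|lborel. LINT z|lborel. F l n (q, z)) = (LINT x|lborel. F l n x)" for l n
    using lborel_pair.integral_fst[of "\<lambda>q z. F l n (q, z)"] Fi[of l n] by (simp add: case_prod_beta' lborel_prod)
  define S where "S x = (\<Sum>l\<le>m. ?b l * F l (Suc l) x)" for x
  have Sc: "continuous_on UNIV S"
    unfolding S_def[abs_def] by (intro continuous_intros Fc)
  have Sz: "S (q, z) = 0" if "(q, z) \<notin> cbox ((- R, - R), - R) ((R, R), R)" for q z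
    using Fz[OF that] by (simp add: S_def)
  have Si: "integrable lborel S"
    unfolding S_def[abs_def] by (intro Bochner_Integration.integrable_sum integrable_mult_right Fi)
  have plane: "S (q, (p - \<omega> $ 1 * fst q - \<omega> $ 2 * snd q) / \<omega> $ 3) =
      exp p * (\<Sum>l\<le>m. ?b l * (- (\<theta> \<bullet> plane_point \<omega> p q)) ^ (l - j) * G l (Suc l) (plane_point \<omega> p q))" for p q
  proof -
    have "point_at (q, (p - \<omega> $ 1 * fst q - \<omega> $ 2 * snd q) / \<omega> $ 3) = plane_point \<omega> p q"
      by (simp add: point_at_def plane_point_def)
    moreover have "\<omega> \<bullet> plane_point \<omega> p q = p"
      using w3 by (simp add: plane_point_def inner_real3)
    ultimately show ?thesis
      by (simp add: S_def F_def sum_distrib_left mult_ac del: fact_Suc)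
  qed
  have "(LINT p|lborel. LINT q|lborel. S (q, (p - \<omega> $ 1 * fst q - \<omega> $ 2 * snd q) / \<omega> $ 3)) = 0"
    unfolding plane by (rule integral_eq_zero_AE, rule AE_mp[OF planes]) simp
  then have "(LINT q|lborel. LINT z|lborel. S (q, z)) = 0"
    using integral_over_parallel_planes[OF Sc Sz w3] w3 by simp
  then have "(LINT x|lborel. S x) = 0"
    using lborel_pair.integral_fst[of "\<lambda>q z. S (q, z)"] Si by (simp add: case_prod_beta' lborel_prod)
  then have sum0: "(\<Sum>l\<le>m. ?b l * (LINT x|lborel. F l (Suc l) x)) = 0"
    unfolding S_def using Fi by (subst (asm) Bochner_Integration.integral_sum) auto
  have parts: "(LINT z|lborel. F l n (q, z)) = (- 1) ^ n * (LINT z|lborel. F l 0 (q, z))" for l n q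
  proof -
    let ?w = "\<omega> $ 1 * fst q + \<omega> $ 2 * snd q"
    let ?t = "(- (\<theta> $ 1 * fst q + \<theta> $ 2 * snd q)) ^ (l - j)"
    let ?g = "\<lambda>n z. \<omega> $ 3 ^ n * G l n (point_at (q, z))"
    have pt: "point_at (q, z) = point_at (q, 0) + z *\<^sub>R axis 3 1" for z
      by (simp add: point_at_def vec_eq_iff forall_3 axis_def)
    \<comment> \<open>The jet along \<open>e\<^sub>3 / \<omega>\<^sub>3\<close>, rescaled to the unit vector \<open>e\<^sub>3\<close>.\<close>
    have jet3: "directional_jet K (axis 3 1) (\<lambda>n x. \<omega> $ 3 ^ n * G l n x)"
      using directional_jet_scale[OF jetG[of l], of "\<omega> $ 3"] w3 by simp
    have "(LINT z|lborel. exp (?w + \<omega> $ 3 * z) * ?g n z) = (- (\<omega> $ 3)) ^ n * (LINT z|lborel. exp (?w + \<omega> $ 3 * z) * ?g 0 z)"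
    proof (rule lborel_integral_parts_exp[where c = R])
      show "continuous_on UNIV (?g n)" for n
        by (intro continuous_intros continuous_on_compose2[OF Gc]) auto
      show "?g n z = 0" if "\<bar>z\<bar> > R" for n z
      proof -
        have "(q, z) \<notin> cbox ((- R, - R), - R) ((R, R), R)"
          using that by (auto simp: cbox_Pair_eq)
        then show ?thesis using Gz by simp
      qed
      show "(?g n has_real_derivative ?g (Suc n) z) (at z)" for n z
        using directional_jet_deriv[OF jet3, of n "point_at (q, 0)" z] by (simp add: pt[symmetric])
    qed
    then have "\<omega> $ 3 ^ n * (LINT z|lborel. exp (?w + \<omega> $ 3 * z) * G l n (point_at (q, z))) =
        \<omega> $ 3 ^ n * ((- 1) ^ n * (LINT z|lborel. exp (?w + \<omega> $ 3 * z) * G l 0 (point_at (q, z))))"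
      by (simp add: mult.left_commute[of _ "\<omega> $ 3 ^ n"] power_minus[of "\<omega> $ 3"])
    then have *: "(LINT z|lborel. exp (?w + \<omega> $ 3 * z) * G l n (point_at (q, z))) =
        (- 1) ^ n * (LINT z|lborel. exp (?w + \<omega> $ 3 * z) * G l 0 (point_at (q, z)))"
      using w3 by simp
    have F: "F l n (q, z) = ?t * (exp (?w + \<omega> $ 3 * z) * G l n (point_at (q, z)))" for n z
      using th3 by (simp add: F_def inner_real3 point_at_def add_ac)
    have "(LINT z|lborel. F l n (q, z)) = ?t * (LINT z|lborel. exp (?w + \<omega> $ 3 * z) * G l n (point_at (q, z)))" for n
      unfolding F by (rule integral_mult_right_zero)
    then have "(LINT z|lborel. F l n (q, z)) = ?t * (LINT z|lborel. exp (?w + \<omega> $ 3 * z) * G l n (point_at (q, z)))"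
      and "(LINT z|lborel. F l 0 (q, z)) = ?t * (LINT z|lborel. exp (?w + \<omega> $ 3 * z) * G l 0 (point_at (q, z)))"
      by blast+
    then show ?thesis
      using * by (simp only: mult.left_commute)
  qed
  have flip: "(LINT x|lborel. F l (Suc l) x) = (- 1) ^ Suc l * (LINT x|lborel. F l 0 x)" for l
  proof -
    have "(LINT q|lborel. LINT z|lborel. F l (Suc l) (q, z)) =
        (LINT q|lborel. (- 1) ^ Suc l * (LINT z|lborel. F l 0 (q, z)))"
      by (intro Bochner_Integration.integral_cong refl parts)
    then show ?thesis
      unfolding integral_mult_right_zero Ffub .
  qed
  have reduce: "real (l choose j) * ((- 1) ^ Suc l * (LINT x|lborel. F l 0 x)) = (- 1) ^ Suc j * (real (l choose j) *
      (LINT x|lborel. exp (\<omega> \<bullet> point_at x) * (\<theta> \<bullet> point_at x) ^ (l - j) * G l 0 (point_at x)))" for l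
  proof (cases "j \<le> l")
    case True
    then obtain i where l: "l = j + i" by (metis le_add_diff_inverse)
    have "F l 0 x = (- 1) ^ i * (exp (\<omega> \<bullet> point_at x) * (\<theta> \<bullet> point_at x) ^ (l - j) * G l 0 (point_at x))" for x
      by (simp add: F_def l power_minus[of "\<theta> \<bullet> point_at x"])
    moreover have "(- 1) ^ Suc l * (- 1) ^ i = ((- 1) ^ Suc j :: real)"
      by (simp add: l power_add flip: power_mult_distrib)
    ultimately show ?thesis
      by (simp add: mult.assoc[symmetric] del: power_Suc) (simp add: mult_ac)
  qed simp
  have "?b l * (LINT x|lborel. F l (Suc l) x) = (- 1) ^ Suc j * (?b l *
      (LINT x|lborel. exp (\<omega> \<bullet> point_at x) * (\<theta> \<bullet> point_at x) ^ (l - j) * G l 0 (point_at x)))" for l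
    unfolding flip mult.assoc[of _ "real (l choose j)"] reduce by (simp only: mult_ac)
  then have "(- 1) ^ Suc j * (\<Sum>l\<le>m. ?b l *
      (LINT x|lborel. exp (\<omega> \<bullet> point_at x) * (\<theta> \<bullet> point_at x) ^ (l - j) * G l 0 (point_at x))) = 0"
    using sum0 by (simp only: sum_distrib_left)
  then show ?thesis
    by (simp del: fact_Suc)
qed

section \<open>Moment relations and uniqueness\<close>

text \<open>Both sides are the Beta integral of \<open>x\<^bsup>a - 1\<^esup> (1 - x)\<^sup>J\<close> over \<open>[0, 1]\<close>; here what matters is that it is
  not zero. The induction uses Pascal's rule, \<open>S (J + 1) a = S J a - S J (a + 1)\<close>.\<close>

lemma alternating_binomial_reciprocal_sum:
  fixes a :: real
  assumes "a > 0"
  shows "(\<Sum>q\<le>J. (- 1) ^ q * real (J choose q) / (a + real q)) = fact J / pochhammer a (Suc J)"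
  using assms
proof (induction J arbitrary: a)
  case (Suc J)
  let ?S = "\<lambda>J a. \<Sum>q\<le>J. (- 1) ^ q * real (J choose q) / (a + real q)"
  have "?S (Suc J) a = 1 / a + (\<Sum>q\<le>J. (- 1) ^ Suc q * real (Suc J choose Suc q) / (a + real (Suc q)))"
    by (subst sum.atMost_Suc_shift) simp
  also have "\<dots> = (1 / a + (\<Sum>q\<le>J. (- 1) ^ Suc q * real (J choose Suc q) / (a + real (Suc q)))) - ?S J (a + 1)"
    by (simp add: sum.distrib[symmetric] sum_subtractf[symmetric] sum_negf[symmetric] field_simps
        add_divide_distrib diff_divide_distrib)
  also have "1 / a + (\<Sum>q\<le>J. (- 1) ^ Suc q * real (J choose Suc q) / (a + real (Suc q))) =
      (\<Sum>q\<le>Suc J. (- 1) ^ q * real (J choose q) / (a + real q))"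
    by (subst sum.atMost_Suc_shift) simp
  also have "\<dots> = ?S J a"
    by (simp add: binomial_eq_0)
  also have "?S J a - ?S J (a + 1) = fact J / pochhammer a (Suc J) - fact J / pochhammer (a + 1) (Suc J)"
    using Suc by simp
  also have "\<dots> = fact (Suc J) / pochhammer a (Suc (Suc J))"
  proof -
    have 1: "pochhammer a (Suc (Suc J)) = pochhammer a (Suc J) * (a + real (Suc J))"
      by (rule pochhammer_Suc)
    have 2: "pochhammer a (Suc (Suc J)) = a * pochhammer (a + 1) (Suc J)"
      by (rule pochhammer_rec)
    have pos: "pochhammer a (Suc J) > 0" "pochhammer (a + 1) (Suc J) > 0" "pochhammer a (Suc (Suc J)) > 0"
      using Suc.prems by (auto intro!: pochhammer_pos simp del: pochhammer_Suc)
    have "fact J / pochhammer a (Suc J) = fact J * (a + real (Suc J)) / pochhammer a (Suc (Suc J))"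
      unfolding 1 using pos Suc.prems by simp
    moreover have "fact J / pochhammer (a + 1) (Suc J) = fact J * a / pochhammer a (Suc (Suc J))"
      unfolding 2 using Suc.prems by simp
    ultimately show ?thesis
      by (simp add: diff_divide_distrib[symmetric] algebra_simps del: pochhammer_Suc)
  qed
  finally show ?case .
qed simp

text \<open>Suppose \<open>A 0 i = 0\<close> for all \<open>i < J\<close>. Differentiating these equations gives \<open>A q i = 0\<close> for
  \<open>q + i < J\<close> and, on the diagonal \<open>q + i = J\<close>, expresses every \<open>A q i\<close> as a multiple of \<open>A 0 J\<close>.
  The relation with \<open>j = m - J\<close> involves only this diagonal, hence reads \<open>c A 0 J = 0\<close> with a constant \<open>c\<close>
  that is a positive multiple of an alternating sum of binomial coefficients, a Beta integral.\<close>

lemma moment_hierarchy_trivial: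
  fixes A :: "nat \<Rightarrow> nat \<Rightarrow> 'v::real_vector \<Rightarrow> real"
  assumes deriv: "\<And>q i k. ((\<lambda>\<tau>. A q i (k + \<tau> *\<^sub>R \<theta>)) has_real_derivative
        A (Suc q) i k + real (m - i) * A q (Suc i) k) (at 0)"
    and rel: "\<And>j k. j \<le> m \<Longrightarrow>
        (\<Sum>l\<le>m. real (m choose l) / fact (Suc l) * real (l choose j) * A (l - j) (m - l) k) = 0"
  shows "J \<le> m \<Longrightarrow> A 0 J k = 0"
proof (induction J arbitrary: k rule: less_induct)
  case (less J)
  have step: "A (Suc q) i k = - real (m - i) * A q (Suc i) k" if "\<And>k. A q i k = 0" for q i k
  proof -
    have "((\<lambda>\<tau>. A q i (k + \<tau> *\<^sub>R \<theta>)) has_real_derivative 0) (at 0)"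
      by (simp add: that)
    from DERIV_unique[OF deriv[of q i k] this] show ?thesis by simp
  qed
  have below: "A q i k = 0" if "q + i < J" for q i k
    using that
  proof (induction q arbitrary: i k)
    case 0
    then show ?case using less by simp
  next
    case (Suc q)
    then show ?case using step[of q i k] by simp
  qed
  define n where "n = m - J"
  have m: "m = n + J" using less.prems by (simp add: n_def)
  \<comment> \<open>On the diagonal, each derivative turns into a factor \<open>- (m - i)\<close>.\<close>
  have diag: "A q (J - q) k = (- 1) ^ q * fact (n + q) / fact n * A 0 J k" if "q \<le> J" for q k
    using that
  proof (induction q)
    case (Suc q)
    then have "A (Suc q) (J - Suc q) k = - real (m - (J - Suc q)) * A q (J - q) k"
      using step[of q "J - Suc q" k] below[of q "J - Suc q"] by (simp add: Suc_diff_Suc)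
    moreover have "m - (J - Suc q) = Suc (n + q)"
      using Suc.prems by (simp add: m)
    ultimately show ?case
      using Suc by (simp add: field_simps)
  qed simp
  have "0 = (\<Sum>l\<le>m. real (m choose l) / fact (Suc l) * real (l choose n) * A (l - n) (m - l) k)"
    using rel[of n k] by (simp add: m)
  also have "\<dots> = (\<Sum>l\<in>{n..m}. real (m choose l) / fact (Suc l) * real (l choose n) * A (l - n) (m - l) k)"
    by (intro sum.mono_neutral_right) auto
  also have "\<dots> = (\<Sum>q\<le>J. real (m choose (n + q)) / fact (Suc (n + q)) * real ((n + q) choose n) * A q (J - q) k)"
    by (rule sum.reindex_bij_witness[of _ "\<lambda>q. n + q" "\<lambda>l. l - n"]) (auto simp: m add.commute)
  also have "\<dots> = (\<Sum>q\<le>J. real (m choose n) / fact n * A 0 J k * ((- 1) ^ q * real (J choose q) / (real (Suc n) + real q)))"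
  proof (intro sum.cong refl)
    fix q assume "q \<in> {..J}"
    then have q: "q \<le> J" by simp
    have "(m choose (n + q)) * ((n + q) choose n) = (m choose n) * (J choose q)"
      using choose_mult[of n "n + q" m] q by (simp add: m)
    then have c: "real (m choose (n + q)) * real ((n + q) choose n) = real (m choose n) * real (J choose q)"
      by (metis of_nat_mult)
    have "fact (Suc (n + q)) = (real (Suc n) + real q) * fact (n + q)"
      by (simp add: algebra_simps)
    then have f: "fact (n + q) / fact (Suc (n + q)) = 1 / (real (Suc n) + real q)"
      by (simp del: fact_Suc)
    have "real (m choose (n + q)) / fact (Suc (n + q)) * real ((n + q) choose n) * A q (J - q) k =
        (real (m choose (n + q)) * real ((n + q) choose n)) * (fact (n + q) / fact (Suc (n + q))) * ((- 1) ^ q / fact n * A 0 J k)"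
      unfolding diag[OF q] by (simp add: mult_ac del: fact_Suc)
    also have "\<dots> = real (m choose n) / fact n * A 0 J k * ((- 1) ^ q * real (J choose q) / (real (Suc n) + real q))"
      unfolding c f by (simp add: mult_ac)
    finally show "real (m choose (n + q)) / fact (Suc (n + q)) * real ((n + q) choose n) * A q (J - q) k =
        real (m choose n) / fact n * A 0 J k * ((- 1) ^ q * real (J choose q) / (real (Suc n) + real q))" .
  qed
  also have "\<dots> = real (m choose n) / fact n * A 0 J k * (fact J / pochhammer (real (Suc n)) (Suc J))"
    unfolding sum_distrib_left[symmetric]
    by (subst alternating_binomial_reciprocal_sum) auto
  finally have "real (m choose n) / fact n * A 0 J k * (fact J / pochhammer (real (Suc n)) (Suc J)) = 0"
    by simp
  moreover have "pochhammer (real (Suc n)) (Suc J) > 0"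
    by (rule pochhammer_pos) simp
  ultimately show ?case
    by (simp add: m del: pochhammer_Suc)
qed

text \<open>For \<open>q = 0\<close> this is the pairing of the Laplace transform of \<open>h\<close> at \<open>k\<close> with \<open>\<theta>\<^sup>i k\<^bsup>m - i\<^esup>\<close>; the factor
  \<open>(\<theta> \<bullet> x)\<^sup>q\<close> stands for \<open>q\<close> derivatives in direction \<open>\<theta>\<close> of the transform.\<close>

definition laplace_moment :: "(real ^ 3 \<Rightarrow> 3 tensor) \<Rightarrow> nat \<Rightarrow> real ^ 3 \<Rightarrow> nat \<Rightarrow> nat \<Rightarrow> real ^ 3 \<Rightarrow> real" where
  "laplace_moment h m \<theta> q i k = (LINT x|lborel. exp (k \<bullet> point_at x) * (\<theta> \<bullet> point_at x) ^ q *
      tensor_pairing (h (point_at x)) (replicate i \<theta> @ replicate (m - i) k))"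

context
  fixes h :: "real ^ 3 \<Rightarrow> 3 tensor" and K :: "(real ^ 3) set"
  assumes cont: "\<And>is. continuous_on UNIV (\<lambda>x. h x is)"
    and zero: "\<And>x is. x \<notin> K \<Longrightarrow> h x is = 0" and K: "bounded K"
    and sym: "\<And>x. perm_invariant (h x)"
begin

lemma field_point_at:
  obtains a b where "\<And>x is. x \<notin> cbox a b \<Longrightarrow> h (point_at x) is = 0"
proof -
  obtain R where R: "\<And>x. x \<in> K \<Longrightarrow> norm x \<le> R"
    using K bounded_iff by blast
  then have "h (point_at x) is = 0" if "x \<notin> cbox ((- R, - R), - R) ((R, R), R)" for x "is"
    using that point_at_component_le zero by blast
  then show ?thesis using that by blast
qed

lemma pairing_point_at_zero:
  "(\<And>is. h (point_at x) is = 0) \<Longrightarrow> tensor_pairing (h (point_at x)) ys = 0"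
  by (simp add: tensor_pairing_def)

lemma continuous_on_field:
  "continuous_on S f \<Longrightarrow> continuous_on S (\<lambda>x. h (f x) is)"
  by (rule continuous_on_compose2[OF cont]) auto

lemma laplace_moment_continuous: "continuous_on UNIV (laplace_moment h m \<theta> q i)"
proof -
  obtain a b where ab: "\<And>x is. x \<notin> cbox a b \<Longrightarrow> h (point_at x) is = 0"
    by (rule field_point_at) blast
  show ?thesis
    unfolding laplace_moment_def[abs_def]
    by (rule lborel_integral_continuous_param[of _ a b])
       (auto simp: case_prod_beta pairing_point_at_zero ab
         intro!: continuous_intros continuous_on_tensor_pairing continuous_on_field)
qed

lemma laplace_moment_has_derivative:
  "((\<lambda>\<tau>. laplace_moment h m \<theta> q i (k + \<tau> *\<^sub>R \<theta>)) has_real_derivative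
     laplace_moment h m \<theta> (Suc q) i k + real (m - i) * laplace_moment h m \<theta> q (Suc i) k) (at 0)"
proof -
  obtain a b where ab: "\<And>x is. x \<notin> cbox a b \<Longrightarrow> h (point_at x) is = 0"
    by (rule field_point_at) blast
  define F where "F q i \<tau> x = exp ((k + \<tau> *\<^sub>R \<theta>) \<bullet> point_at x) * (\<theta> \<bullet> point_at x) ^ q *
      tensor_pairing (h (point_at x)) (replicate i \<theta> @ replicate (m - i) (k + \<tau> *\<^sub>R \<theta>))" for q i \<tau> x
  have Fc: "continuous_on UNIV (\<lambda>(\<tau>, x). F q i \<tau> x)" for q i
    unfolding F_def case_prod_beta
    by (intro continuous_intros continuous_on_tensor_pairing continuous_on_field)
  have Fz: "F q i \<tau> x = 0" if "x \<notin> cbox a b" for q i \<tau> x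
    using that by (simp add: F_def pairing_point_at_zero ab)
  have lm: "laplace_moment h m \<theta> q i (k + \<tau> *\<^sub>R \<theta>) = (LINT x|lborel. F q i \<tau> x)" for q i \<tau>
    by (simp add: laplace_moment_def F_def)
  have d: "((\<lambda>\<tau>. F q i \<tau> x) has_real_derivative F (Suc q) i \<tau> x + real (m - i) * F q (Suc i) \<tau> x) (at \<tau>)" for \<tau> x
  proof -
    let ?e = "\<lambda>\<tau>. exp ((k + \<tau> *\<^sub>R \<theta>) \<bullet> point_at x) * (\<theta> \<bullet> point_at x) ^ q"
    let ?p = "\<lambda>i \<tau>. tensor_pairing (h (point_at x)) (replicate i \<theta> @ replicate (m - i) (k + \<tau> *\<^sub>R \<theta>))"
    have "(?e has_real_derivative ?e \<tau> * (\<theta> \<bullet> point_at x)) (at \<tau>)"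
      by (auto simp: inner_add_left intro!: derivative_eq_intros)
    moreover have "(?p i has_real_derivative real (m - i) * ?p (Suc i) \<tau>) (at \<tau>)"
      using tensor_pairing_has_derivative[OF sym, of "point_at x" "replicate i \<theta>" "m - i" k \<theta> \<tau>]
      by (simp add: replicate_app_Cons_same)
    ultimately have "((\<lambda>\<tau>. ?e \<tau> * ?p i \<tau>) has_real_derivative
        ?e \<tau> * (\<theta> \<bullet> point_at x) * ?p i \<tau> + (real (m - i) * ?p (Suc i) \<tau>) * ?e \<tau>) (at \<tau>)"
      by (rule DERIV_mult)
    then show ?thesis
      by (simp add: F_def mult_ac)
  qed
  have "((\<lambda>\<tau>. LINT x|lborel. F q i \<tau> x) has_real_derivative
      (LINT x|lborel. F (Suc q) i 0 x + real (m - i) * F q (Suc i) 0 x)) (at 0)"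
  proof (rule lborel_integral_has_derivative_param[OF Fc _ d Fz])
    show "continuous_on UNIV (\<lambda>(\<tau>, x). F (Suc q) i \<tau> x + real (m - i) * F q (Suc i) \<tau> x)"
      using Fc[of "Suc q" i] Fc[of q "Suc i"] unfolding case_prod_beta by (intro continuous_intros)
  qed (use Fz in auto)
  also have "(LINT x|lborel. F (Suc q) i 0 x + real (m - i) * F q (Suc i) 0 x) =
      (LINT x|lborel. F (Suc q) i 0 x) + real (m - i) * (LINT x|lborel. F q (Suc i) 0 x)"
    using lborel_integral_cbox(1)[OF continuous_on_section[OF Fc] Fz] by simp
  finally show ?thesis
    using lm[of _ _ 0] by (simp add: lm)
qed

text \<open>The vectors \<open>\<theta>\<close> with \<open>\<theta> $ 3 = 0\<close> and \<open>k\<close> together span the space unless \<open>k $ 3 = 0\<close>, and the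
  exceptional \<open>k\<close> are reached by continuity of the Laplace transform.\<close>

lemma field_zero_if_moment_relations:
  assumes rel: "\<And>\<theta> j k. \<theta> $ 3 = 0 \<Longrightarrow> j \<le> m \<Longrightarrow>
      (\<Sum>l\<le>m. real (m choose l) / fact (Suc l) * real (l choose j) * laplace_moment h m \<theta> (l - j) (m - l) k) = 0"
    and len: "length is = m"
  shows "h x is = 0"
proof -
  have A0: "laplace_moment h m \<theta> 0 J k = 0" if "\<theta> $ 3 = 0" "J \<le> m" for \<theta> J k
    by (rule moment_hierarchy_trivial[where A = "laplace_moment h m \<theta>" and \<theta> = \<theta> and m = m])
       (use that rel laplace_moment_has_derivative in auto)
  obtain a b where ab: "\<And>x is. x \<notin> cbox a b \<Longrightarrow> h (point_at x) is = 0"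
    by (rule field_point_at) blast
  have pc: "continuous_on UNIV (\<lambda>x. tensor_pairing (h (point_at x)) ys)" for ys
    unfolding tensor_pairing_def
    by (intro continuous_on_sum continuous_on_mult continuous_on_const continuous_on_field continuous_intros)
  have laplace: "(LINT x|lborel. exp (k \<bullet> point_at x) * tensor_pairing (h (point_at x)) (replicate m v)) = 0" for v k
  proof (rule continuous_zero_on_dense[where x = k])
    show "continuous_on UNIV (\<lambda>k. LINT x|lborel. exp (k \<bullet> point_at x) * tensor_pairing (h (point_at x)) (replicate m v))"
      by (rule lborel_integral_continuous_param[of _ a b])
         (auto simp: case_prod_beta pairing_point_at_zero ab
           intro!: continuous_intros continuous_on_compose2[OF pc])
  next
    fix U :: "(real ^ 3) set" assume "open U" "U \<noteq> {}"
    then obtain k where k: "k \<in> U" "k $ 3 \<noteq> 0"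
      using open_Int_nonhorizontal by blast
    define c where "c = v $ 3 / k $ 3"
    define \<theta> where "\<theta> = v - c *\<^sub>R k"
    have th3: "\<theta> $ 3 = 0" using k by (simp add: \<theta>_def c_def)
    have v: "v = 1 *\<^sub>R \<theta> + c *\<^sub>R k" by (simp add: \<theta>_def)
    let ?p = "\<lambda>r x. tensor_pairing (h (point_at x)) (replicate r \<theta> @ replicate (m - r) k)"
    have int: "integrable lborel (\<lambda>x. exp (k \<bullet> point_at x) * ?p r x)" for r
      by (rule lborel_integral_cbox(1)[of _ a b])
         (auto intro!: continuous_intros continuous_on_compose2[OF pc] simp: pairing_point_at_zero ab)
    have "tensor_pairing (h (point_at x)) (replicate m v) = (\<Sum>r\<le>m. real (m choose r) * c ^ (m - r) * ?p r x)" for x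
      using tensor_pairing_binomial[OF sym, of "point_at x" "[]" m 1 \<theta> c k] v by simp
    then have "(LINT x|lborel. exp (k \<bullet> point_at x) * tensor_pairing (h (point_at x)) (replicate m v)) =
        (LINT x|lborel. (\<Sum>r\<le>m. real (m choose r) * c ^ (m - r) * (exp (k \<bullet> point_at x) * ?p r x)))"
      by (simp add: sum_distrib_left mult_ac)
    also have "\<dots> = (\<Sum>r\<le>m. real (m choose r) * c ^ (m - r) * laplace_moment h m \<theta> 0 r k)"
      using int by (subst Bochner_Integration.integral_sum) (auto simp: laplace_moment_def)
    also have "\<dots> = 0"
      using A0[OF th3] by simp
    finally show "\<exists>k\<in>U. (LINT x|lborel. exp (k \<bullet> point_at x) * tensor_pairing (h (point_at x)) (replicate m v)) = 0"
      using k by blast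
  qed
  have pz: "tensor_pairing (h (point_at x)) (replicate m v) = 0" for v x
  proof (rule laplace_transform_injective[OF pc])
    show "tensor_pairing (h (point_at x)) (replicate m v) = 0" if "x \<notin> cbox a b" for x
      using that by (simp add: pairing_point_at_zero ab)
    show "(LINT x|lborel. exp (k \<bullet> x) * tensor_pairing (h (point_at x)) (replicate m v)) = 0" for k :: "(real \<times> real) \<times> real"
    proof -
      have "k \<bullet> x = point_at k \<bullet> point_at x" for x
        by (simp add: point_at_def inner_prod_def inner_real3)
      then show ?thesis using laplace by simp
    qed
  qed
  have "tensor_pairing (h x) (replicate m v) = 0" for v
  proof -
    have "x = point_at ((x $ 1, x $ 2), x $ 3)"
      by (simp add: point_at_def vec_eq_iff forall_3)
    then show ?thesis using pz by metis
  qed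
  then show ?thesis
    using tensor_zero_if_diagonal_zero[OF sym] len by blast
qed

end

theorem theorem1:
  fixes m :: nat
    and B \<gamma> :: "(real ^ 3) set"
    and \<Phi>\<^sub>1 \<Phi>\<^sub>2 :: "real ^ 3 \<Rightarrow> real"
    and f g :: "real ^ 3 \<Rightarrow> 3 tensor"
  assumes "m \<ge> 1"
    and "bounded_domain B"
    and "curve \<gamma>"
    and "kirillov_tuy m B \<gamma>"
    and "encompasses \<gamma> B"
    and "angle_choice \<Phi>\<^sub>1 \<Phi>\<^sub>2"
    and "smooth_compact_symmetric_field m f" and "field_support f \<subseteq> B"
    and "smooth_compact_symmetric_field m g" and "field_support g \<subseteq> B"
    and "\<And>a \<xi> i. a \<in> \<gamma> \<Longrightarrow> \<xi> \<in> sphere 0 1 \<Longrightarrow> i \<le> m \<Longrightarrow>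
           transverse_ray_transform \<Phi>\<^sub>1 \<Phi>\<^sub>2 m i f a \<xi> = transverse_ray_transform \<Phi>\<^sub>1 \<Phi>\<^sub>2 m i g a \<xi>"
  shows "f = g"
proof -
  define h where "h x is = f x is - g x is" for x "is"
  define K where "K = field_support f \<union> field_support g"
  have KB: "K \<subseteq> B" using assms(8,10) by (simp add: K_def)
  have cK: "compact K"
    using assms(7,9) by (auto simp: K_def smooth_compact_symmetric_field_def)
  then have bK: "bounded K" and clK: "closed K"
    by (auto simp: compact_imp_bounded compact_imp_closed)
  have fz: "f x is = 0" and gz: "g x is = 0" if "x \<notin> K" for x "is"
    using that by (auto simp: K_def field_support_zero)
  have smooth: "smooth_on UNIV (\<lambda>x. f x is)" "smooth_on UNIV (\<lambda>x. g x is)" for "is"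
    using assms(7,9) by (auto simp: smooth_compact_symmetric_field_def)
  have symt: "symmetric_tensor m (f x)" "symmetric_tensor m (g x)" for x
    using assms(7,9) by (auto simp: smooth_compact_symmetric_field_def)
  then have sym: "perm_invariant (h x)" for x
    unfolding perm_invariant_def symmetric_tensor_def h_def by metis
  define H where "H d n x is = ((\<lambda>u x. frechet_derivative u (at x) d) ^^ n) (\<lambda>x. f x is) x
      - ((\<lambda>u x. frechet_derivative u (at x) d) ^^ n) (\<lambda>x. g x is) x" for d n x "is"
  have jet: "directional_jet K d (\<lambda>n x. H d n x is)" for d "is"
    unfolding H_def by (intro directional_jet_diff smooth_on_directional_jet smooth fz gz clK)
  have H0: "H d 0 = h" for d
    by (simp add: H_def h_def fun_eq_iff)
  have cont: "continuous_on UNIV (\<lambda>x. h x is)" for "is"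
    using directional_jet_continuous[OF jet, of 0 0] by (simp add: H0)
  have hz: "h x is = 0" if "x \<notin> K" for x "is"
    using that by (simp add: h_def fz gz)
  have B: "open B" using assms(2) by (simp add: bounded_domain_def)
  have data: "(LINT t|lborel. tensor_pairing (h (a + t *\<^sub>R \<xi>)) (replicate m \<eta>)) = 0"
    if "a \<in> \<gamma>" "\<xi> \<noteq> 0" "\<eta> \<bullet> \<xi> = 0" for a \<xi> \<eta>
    using vanishing_transverse_data[OF assms(6,7,9) assms(11)[OF that(1)] that(2,3)]
    by (simp add: h_def[abs_def])
  have side: "(\<forall>t\<ge>0. a + t *\<^sub>R \<xi> \<notin> K) \<or> (\<forall>t\<le>0. a + t *\<^sub>R \<xi> \<notin> K)" if "a \<in> \<gamma>" "\<xi> \<noteq> 0" for a \<xi>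
    using assms(5) that KB unfolding encompasses_def by blast
  have rel: "(\<Sum>l\<le>m. real (m choose l) / fact (Suc l) * real (l choose j) *
      laplace_moment h m \<theta> (l - j) (m - l) k) = 0" if th3: "\<theta> $ 3 = 0" and j: "j \<le> m" for \<theta> j k
  proof (rule continuous_zero_on_dense[where x = k])
    show "continuous_on UNIV (\<lambda>k. \<Sum>l\<le>m. real (m choose l) / fact (Suc l) * real (l choose j) *
        laplace_moment h m \<theta> (l - j) (m - l) k)"
      by (intro continuous_on_sum continuous_on_mult continuous_on_const
          laplace_moment_continuous[OF cont hz bK sym])
  next
    fix U :: "(real ^ 3) set" assume "open U" "U \<noteq> {}"
    from kirillov_tuy_distinct_points[OF assms(4) B open_Int_nonhorizontal[OF this]]
    obtain \<omega> where \<omega>: "\<omega> \<in> U" "\<omega> $ 3 \<noteq> 0"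
      and pts: "AE p in lborel. hyperplane \<omega> p \<inter> B \<noteq> {} \<longrightarrow>
           (\<exists>c. inj_on c {..m} \<and> c ` {..m} \<subseteq> hyperplane \<omega> p \<inter> \<gamma>)"
      by blast
    define d where "d = (1 / \<omega> $ 3) *\<^sub>R (axis 3 1 :: real ^ 3)"
    let ?G = "\<lambda>\<theta> l n x. tensor_pairing (H d n x) (replicate l \<omega> @ replicate (m - l) \<theta>)"
    have jetd: "directional_jet K ((1 / \<omega> $ 3) *\<^sub>R axis 3 1) (\<lambda>n x. H d n x is)" for "is"
      using jet[of d] by (simp add: d_def)
    have planes: "AE p in lborel. (LINT q|lborel. (\<Sum>l\<le>m. real (m choose l) / fact (Suc l) * real (l choose j) *
        (- (\<theta> \<bullet> plane_point \<omega> p q)) ^ (l - j) * ?G \<theta> l (Suc l) (plane_point \<omega> p q))) = 0"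
      using pts
    proof (rule AE_mp, intro AE_I2 impI)
      fix p assume *: "hyperplane \<omega> p \<inter> B \<noteq> {} \<longrightarrow>
           (\<exists>c. inj_on c {..m} \<and> c ` {..m} \<subseteq> hyperplane \<omega> p \<inter> \<gamma>)"
      show "(LINT q|lborel. (\<Sum>l\<le>m. real (m choose l) / fact (Suc l) * real (l choose j) *
        (- (\<theta> \<bullet> plane_point \<omega> p q)) ^ (l - j) * ?G \<theta> l (Suc l) (plane_point \<omega> p q))) = 0"
      proof (cases "hyperplane \<omega> p \<inter> B = {}")
        case True
        have "plane_point \<omega> p q \<in> hyperplane \<omega> p" for q
          using \<omega>(2) by (simp add: hyperplane_def plane_point_def inner_real3)
        then have "plane_point \<omega> p q \<notin> K" for q
          using True KB by blast
        then have "?G \<theta> l n (plane_point \<omega> p q) = 0" for l n q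
          using directional_jet_zero[OF directional_jet_tensor_pairing[of K d "H d", OF jet]] by blast
        then show ?thesis by simp
      next
        case False
        with * obtain c where c: "inj_on c {..m}" "c ` {..m} \<subseteq> hyperplane \<omega> p \<inter> \<gamma>" by blast
        then have cp: "\<omega> \<bullet> c k = p" and c\<gamma>: "c k \<in> \<gamma>" if "k \<le> m" for k
          using that by (auto simp: hyperplane_def)
        show ?thesis
        proof (rule plane_coefficients_vanish[OF jetd bK \<omega>(2) th3 j c(1) cp])
          fix \<theta> :: "real ^ 3" and k assume th: "\<theta> $ 3 = 0" and k: "k \<le> m"
          have "(LINT q|lborel. (\<Sum>l\<le>m. real (m choose l) / fact (Suc l) *
              (\<theta> \<bullet> c k - \<theta> \<bullet> plane_point \<omega> (\<omega> \<bullet> c k) q) ^ l *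
              ?G \<theta> l (Suc l) (plane_point \<omega> (\<omega> \<bullet> c k) q))) = 0"
          proof (rule plane_identity[OF jetd bK _ \<omega>(2) th])
            show "perm_invariant (H d 0 x)" for x
              by (simp add: H0 sym)
            show "(\<forall>t\<ge>0. c k + t *\<^sub>R \<xi> \<notin> K) \<or> (\<forall>t\<le>0. c k + t *\<^sub>R \<xi> \<notin> K)" if "\<xi> \<noteq> 0" for \<xi>
              by (rule side[OF c\<gamma>[OF k] that])
            show "(LINT t|lborel. tensor_pairing (H d 0 (c k + t *\<^sub>R \<xi>)) (replicate m \<eta>)) = 0"
              if "\<xi> \<noteq> 0" "\<eta> \<bullet> \<xi> = 0" for \<xi> \<eta>
              unfolding H0 by (rule data[OF c\<gamma>[OF k] that])
          qed
          then show "(LINT q|lborel. (\<Sum>l\<le>m. real (m choose l) / fact (Suc l) *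
              (\<theta> \<bullet> c k - \<theta> \<bullet> plane_point \<omega> p q) ^ l * ?G \<theta> l (Suc l) (plane_point \<omega> p q))) = 0"
            by (simp only: cp[OF k])
        qed
      qed
    qed
    have "(\<Sum>l\<le>m. real (m choose l) / fact (Suc l) * real (l choose j) *
        (LINT x|lborel. exp (\<omega> \<bullet> point_at x) * (\<theta> \<bullet> point_at x) ^ (l - j) * ?G \<theta> l 0 (point_at x))) = 0"
      by (rule laplace_identity[OF jetd bK \<omega>(2) th3 planes])
    also have "(\<Sum>l\<le>m. real (m choose l) / fact (Suc l) * real (l choose j) *
        (LINT x|lborel. exp (\<omega> \<bullet> point_at x) * (\<theta> \<bullet> point_at x) ^ (l - j) * ?G \<theta> l 0 (point_at x))) =
      (\<Sum>l\<le>m. real (m choose l) / fact (Suc l) * real (l choose j) * laplace_moment h m \<theta> (l - j) (m - l) \<omega>)"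
      unfolding laplace_moment_def H0
      by (intro sum.cong refl) (simp add: tensor_pairing_replicate_commute sym)
    finally show "\<exists>k\<in>U. (\<Sum>l\<le>m. real (m choose l) / fact (Suc l) * real (l choose j) *
        laplace_moment h m \<theta> (l - j) (m - l) k) = 0"
      using \<omega>(1) by blast
  qed
  have "f x is = g x is" for x "is"
  proof (cases "length is = m")
    case True
    have "h x is = 0"
      by (rule field_zero_if_moment_relations[OF cont hz bK sym rel True])
    then show ?thesis by (simp add: h_def)
  next
    case False
    then show ?thesis using symt[of x] by (simp add: symmetric_tensor_def)
  qed
  then show ?thesis by (intro ext)
qed

end
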